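(* Let $k\ge1$ and $\boldsymbol{\lambda}=(\lambda_1,\dots,\lambda_k)\in(0,\infty)^k$. The generalized helicoid $\mathcal{H}_{\boldsymbol{\lambda}}$ is stable if and only if $$q_{\boldsymbol{\lambda}}[f]\ge0\qquad\text{for all } f\in C_c^\infty(\mathbb{R}^k;\mathbb{R}^k).$$ Moreover, if this condition fails, then $\operatorname{ind}\mathcal{H}_{\boldsymbol{\lambda}}=\infty$.
   Context: For $\boldsymbol{\lambda}\in(0,\infty)^k$, the generalized helicoid $\mathcal{H}_{\boldsymbol{\lambda}}\subset\mathbb{C}^k\times\mathbb{R}\cong\mathbb{R}^{2k+1}$ is the $(k+1)$-dimensional minimal submanifold parametrized by $(u_1,\dots,u_k,s)\mapsto(u_1e^{i\lambda_1s},\dots,u_ke^{i\lambda_ks},s)$, $(u,s)\in\mathbb{R}^k\times\mathbb{R}$. For $f=(f^1,\dots,f^k)\in C_c^\infty(\mathbb{R}^k;\mathbb{R}^k)$ define $$q_{\boldsymbol{\lambda}}[f]=\int_{\mathbb{R}^k}h\left[\sum_{j=1}^k|\nabla f^j|^2+\Big|\nabla\Big(\sum_{j=1}^k\lambda_ju_jf^j\Big)\Big|^2-\frac{3\sum_{j=1}^k(\lambda_jf^j)^2}{h^2}\right]du,\qquad h=\sqrt{1+\sum_{j=1}^k(\lambda_ju_j)^2},$$ with $u_1,\dots,u_k$ the standard coordinates on $\mathbb{R}^k$ and $\nabla$ the standard gradient. The second variation of area in the direction of a smooth compactly supported normal vector field $V$ on a minimal submanifold $M$ of Euclidean space is $$Q(V,V)=\int_{M}\Big(\sum_{a}|\nabla^\perp_{E_a}V|^2-\sum_{a,b}\langle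 \mathrm{II}(E_a,E_b),V\rangle^2\Big)\,d\mu_M,$$ where $\{E_a\}$ is any local orthonormal tangent frame, $\nabla^\perp$ is the normal connection, and $\mathrm{II}$ is the second fundamental form. $M$ is stable if $Q(V,V)\ge0$ for every such $V$. The index $\operatorname{ind}M\in\{0,1,2,\dots,\infty\}$ is the supremum of the dimensions of linear subspaces of the space of smooth compactly supported normal vector fields on which $Q$ is negative definite. *)

theory Defs
  imports "HOL-Analysis.Analysis" "HOL-Library.Function_Algebras"
begin

section \<open>Smooth compactly supported maps\<close>

(* Ck_map n f: f is of class C^n.  In finite dimensions C^(n+1) means differentiable with all
   directional derivatives of class C^n. *)
primrec Ck_map :: "nat \<Rightarrow> ('a::euclidean_space \<Rightarrow> 'b::real_normed_vector) \<Rightarrow> bool" where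
  "Ck_map 0 f \<longleftrightarrow> continuous_on UNIV f"
| "Ck_map (Suc n) f \<longleftrightarrow> (\<forall>x. f differentiable (at x)) \<and>
     (\<forall>v. Ck_map n (\<lambda>x. frechet_derivative f (at x) v))"

definition smooth_map :: "('a::euclidean_space \<Rightarrow> 'b::real_normed_vector) \<Rightarrow> bool" where
  "smooth_map f \<longleftrightarrow> (\<forall>n. Ck_map n f)"

definition compactly_supported :: "('a::topological_space \<Rightarrow> 'b::zero) \<Rightarrow> bool" where
  "compactly_supported f \<longleftrightarrow> compact (closure {x. f x \<noteq> 0})"

definition grad :: "('a::real_inner \<Rightarrow> real) \<Rightarrow> 'a \<Rightarrow> 'a" where
  "grad g x = (THE D. GDERIV g x :> D)"


section \<open>Second variation of area\<close>

(* A submanifold M of 'b is represented by a global parametrization F: a smooth embedding of the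
   whole space 'a onto M.  Everything on M is pulled back along F: a point x stands for F x, a
   parameter vector v stands for the tangent vector (dF_x) v, and a normal field on M is a map V
   with V x normal to M at F x; such a field is smooth, resp. compactly supported, on M iff V is. *)

definition tangent_space :: "('a::euclidean_space \<Rightarrow> 'b::euclidean_space) \<Rightarrow> 'a \<Rightarrow> 'b set" where
  "tangent_space F x = range (frechet_derivative F (at x))"

definition normal_space :: "('a::euclidean_space \<Rightarrow> 'b::euclidean_space) \<Rightarrow> 'a \<Rightarrow> 'b set" where
  "normal_space F x = (tangent_space F x)\<^sup>\<bottom>"

definition normal_proj :: "('a::euclidean_space \<Rightarrow> 'b::euclidean_space) \<Rightarrow> 'a \<Rightarrow> 'b \<Rightarrow> 'b" where
  "normal_proj F x w = (THE n. n \<in> normal_space F x \<and> w - n \<in> tangent_space F x)"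

definition normal_connection ::
    "('a::euclidean_space \<Rightarrow> 'b::euclidean_space) \<Rightarrow> ('a \<Rightarrow> 'b) \<Rightarrow> 'a \<Rightarrow> 'a \<Rightarrow> 'b" where
  "normal_connection F V x v = normal_proj F x (frechet_derivative V (at x) v)"

(* II(X, Y) is the normal part of D_X Y, evaluated on the field Y = dF(w) that extends
   (dF_x) w tangentially. *)
definition second_fundamental_form ::
    "('a::euclidean_space \<Rightarrow> 'b::euclidean_space) \<Rightarrow> 'a \<Rightarrow> 'a \<Rightarrow> 'a \<Rightarrow> 'b" where
  "second_fundamental_form F x v w =
     normal_proj F x (frechet_derivative (\<lambda>y. frechet_derivative F (at y) w) (at x) v)"

(* The images (dF_x) v, v in B, form an orthonormal basis of the tangent space at F x. *)
definition orthonormal_frame ::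
    "('a::euclidean_space \<Rightarrow> 'b::euclidean_space) \<Rightarrow> 'a \<Rightarrow> 'a set \<Rightarrow> bool" where
  "orthonormal_frame F x B \<longleftrightarrow>
     (\<forall>v\<in>B. \<forall>w\<in>B. frechet_derivative F (at x) v \<bullet> frechet_derivative F (at x) w
        = (if v = w then 1 else 0)) \<and>
     span B = UNIV"

(* The choice of frame is immaterial: both sums are independent of it. *)
definition second_variation_density ::
    "('a::euclidean_space \<Rightarrow> 'b::euclidean_space) \<Rightarrow> ('a \<Rightarrow> 'b) \<Rightarrow> 'a \<Rightarrow> real" where
  "second_variation_density F V x =
     (let B = (SOME B. orthonormal_frame F x B)
      in (\<Sum>a\<in>B. (norm (normal_connection F V x a))\<^sup>2)
         - (\<Sum>a\<in>B. \<Sum>b\<in>B. (second_fundamental_form F x a b \<bullet> V x)\<^sup>2))"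

(* sqrt (det g) for the Gram matrix g of the induced metric in the standard basis; the
   determinant is the Leibniz formula of the library's det with index set Basis. *)
definition volume_density :: "('a::euclidean_space \<Rightarrow> 'b::euclidean_space) \<Rightarrow> 'a \<Rightarrow> real" where
  "volume_density F x = sqrt (\<Sum>p | p permutes (Basis :: 'a set). of_int (sign p) *
     (\<Prod>b\<in>Basis. frechet_derivative F (at x) b \<bullet> frechet_derivative F (at x) (p b)))"

definition second_variation ::
    "('a::euclidean_space \<Rightarrow> 'b::euclidean_space) \<Rightarrow> ('a \<Rightarrow> 'b) \<Rightarrow> real" where
  "second_variation F V =
     (\<integral>x. second_variation_density F V x * volume_density F x \<partial>lborel)"

definition normal_fields :: "('a::euclidean_space \<Rightarrow> 'b::euclidean_space) \<Rightarrow> ('a \<Rightarrow> 'b) set" where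
  "normal_fields F =
     {V. smooth_map V \<and> compactly_supported V \<and> (\<forall>x. V x \<in> normal_space F x)}"

definition stable_submanifold :: "('a::euclidean_space \<Rightarrow> 'b::euclidean_space) \<Rightarrow> bool" where
  "stable_submanifold F \<longleftrightarrow> (\<forall>V\<in>normal_fields F. second_variation F V \<ge> 0)"


section \<open>Index\<close>

instantiation "fun" :: (type, real_vector) real_vector
begin

definition scaleR_fun :: "real \<Rightarrow> ('a \<Rightarrow> 'b) \<Rightarrow> 'a \<Rightarrow> 'b" where
  "scaleR_fun c f = (\<lambda>x. c *\<^sub>R f x)"

instance
  by standard (auto simp: scaleR_fun_def fun_eq_iff scaleR_add_right scaleR_add_left)

end

(* dim is 0 on infinite-dimensional spaces, hence the case distinction. *)
definition edim :: "'v::real_vector set \<Rightarrow> enat" where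
  "edim W = (if \<exists>B. finite B \<and> W \<subseteq> span B then enat (dim W) else \<infinity>)"

definition index_submanifold :: "('a::euclidean_space \<Rightarrow> 'b::euclidean_space) \<Rightarrow> enat" where
  "index_submanifold F =
     (SUP W\<in>{W. subspace W \<and> W \<subseteq> normal_fields F \<and>
                (\<forall>V\<in>W. V \<noteq> 0 \<longrightarrow> second_variation F V < 0)}. edim W)"


section \<open>Generalized helicoids\<close>

definition helicoid :: "real^'k::finite \<Rightarrow> (real^'k) \<times> real \<Rightarrow> (complex^'k) \<times> real" where
  "helicoid l = (\<lambda>(u, s). (\<chi> j. of_real (u $ j) * exp (\<i> * of_real (l $ j * s)), s))"

definition helicoid_h :: "real^'k::finite \<Rightarrow> real^'k \<Rightarrow> real" where
  "helicoid_h l u = sqrt (1 + (\<Sum>j\<in>UNIV. (l $ j * u $ j)\<^sup>2))"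

definition helicoid_q :: "real^'k::finite \<Rightarrow> (real^'k \<Rightarrow> real^'k) \<Rightarrow> real" where
  "helicoid_q l f =
     (\<integral>u. helicoid_h l u *
        ((\<Sum>j\<in>UNIV. (norm (grad (\<lambda>v. f v $ j) u))\<^sup>2)
         + (norm (grad (\<lambda>v. \<Sum>j\<in>UNIV. l $ j * v $ j * f v $ j) u))\<^sup>2
         - 3 * (\<Sum>j\<in>UNIV. (l $ j * f u $ j)\<^sup>2) / (helicoid_h l u)\<^sup>2) \<partial>lborel)"

end

theory Submission
  imports Defs
begin

text \<open>
  Every normal field is \<open>(i a\<^sub>j e^(i \<lambda>\<^sub>j s), - \<Sum>\<^sub>j \<lambda>\<^sub>j u\<^sub>j a\<^sub>j)\<close> for a unique \<open>a(u, s)\<close>.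
  In the orthonormal frame \<open>\<partial>\<^sub>u\<close>, \<open>h\<inverse> \<partial>\<^sub>s\<close> the second
  variation becomes \<open>\<integral> q[a(\<cdot>, s)] ds\<close> plus the nonnegative term
  \<open>\<integral>\<integral> (|\<partial>\<^sub>s a|\<^sup>2 + (\<Sum>\<^sub>j \<lambda>\<^sub>j u\<^sub>j \<partial>\<^sub>s a\<^sub>j)\<^sup>2) / h du ds\<close>. So \<open>q \<ge> 0\<close> gives stability.
  If \<open>q[f] < 0\<close>, take \<open>a = \<phi>(s) f(u)\<close>: the first term is \<open>q[f] \<integral> \<phi>\<^sup>2\<close>, the second a constant
  times \<open>\<integral> \<phi>'\<^sup>2\<close>, and stretching \<open>\<phi>\<close> makes the sum negative. Translates of \<open>\<phi>\<close> with
  disjoint supports span negative definite subspaces of every finite dimension.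
\<close>

section \<open>Calculus of smooth maps\<close>

text \<open>Derivatives are unique, so an explicit \<open>f'\<close> may replace
  \<open>frechet_derivative\<close>; the inductions below go through this rule.\<close>

lemma Ck_map_SucI:
  assumes "\<And>x. (f has_derivative f' x) (at x)" "\<And>v. Ck_map n (\<lambda>x. f' x v)"
  shows "Ck_map (Suc n) f"
proof -
  have "frechet_derivative f (at x) = f' x" for x
    using frechet_derivative_at[OF assms(1)] by simp
  then show ?thesis
    using assms by (auto simp: differentiable_def)
qed

lemma Ck_map_Suc_has_derivative:
  assumes "Ck_map (Suc n) f"
  shows "(f has_derivative frechet_derivative f (at x)) (at x)"
  using assms by (simp add: frechet_derivative_works)

lemma Ck_map_Suc_imp_Ck_map: "Ck_map (Suc n) f \<Longrightarrow> Ck_map n f"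
proof (induction n arbitrary: f)
  case 0
  then show ?case
    by (auto intro!: continuous_at_imp_continuous_on differentiable_imp_continuous_within)
next
  case (Suc n)
  then show ?case by (metis Ck_map.simps(2))
qed

lemma Ck_map_const: "Ck_map n (\<lambda>x. c)"
proof (induction n arbitrary: c)
  case (Suc n)
  show ?case by (rule Ck_map_SucI[where f' = "\<lambda>x v. 0"]) (auto intro: Suc)
qed simp

lemma Ck_map_bounded_linear:
  assumes "bounded_linear L"
  shows "Ck_map n L"
proof (cases n)
  case 0
  then show ?thesis using assms by (simp add: linear_continuous_on)
next
  case (Suc m)
  show ?thesis unfolding Suc
    by (rule Ck_map_SucI[where f' = "\<lambda>x. L"])
       (auto intro: Ck_map_const bounded_linear_imp_has_derivative assms)
qed

lemma Ck_map_compose_linear: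
  assumes "bounded_linear L"
  shows "Ck_map n f \<Longrightarrow> Ck_map n (\<lambda>x. L (f x))"
proof (induction n arbitrary: f)
  case 0
  then show ?case by (auto intro: bounded_linear.continuous_on assms)
next
  case (Suc n)
  show ?case
  proof (rule Ck_map_SucI[where f' = "\<lambda>x v. L (frechet_derivative f (at x) v)"])
    show "((\<lambda>x. L (f x)) has_derivative (\<lambda>v. L (frechet_derivative f (at x) v))) (at x)" for x
      by (rule bounded_linear.has_derivative[OF assms Ck_map_Suc_has_derivative[OF Suc.prems]])
    show "Ck_map n (\<lambda>x. L (frechet_derivative f (at x) v))" for v
      using Suc by simp
  qed
qed

lemma Ck_map_add: "Ck_map n f \<Longrightarrow> Ck_map n g \<Longrightarrow> Ck_map n (\<lambda>x. f x + g x)"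
proof (induction n arbitrary: f g)
  case 0
  then show ?case by (auto intro: continuous_intros)
next
  case (Suc n)
  show ?case
  proof (rule Ck_map_SucI[where f' = "\<lambda>x v. frechet_derivative f (at x) v + frechet_derivative g (at x) v"])
    show "((\<lambda>x. f x + g x) has_derivative
        (\<lambda>v. frechet_derivative f (at x) v + frechet_derivative g (at x) v)) (at x)" for x
      by (intro has_derivative_add Ck_map_Suc_has_derivative[OF Suc.prems(1)]
          Ck_map_Suc_has_derivative[OF Suc.prems(2)])
    show "Ck_map n (\<lambda>x. frechet_derivative f (at x) v + frechet_derivative g (at x) v)" for v
      using Suc by simp
  qed
qed

lemma Ck_map_sum:
  assumes "\<And>i. i \<in> I \<Longrightarrow> Ck_map n (f i)"
  shows "Ck_map n (\<lambda>x. \<Sum>i\<in>I. f i x)"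
  using assms by (induction I rule: infinite_finite_induct) (auto intro: Ck_map_const Ck_map_add)

text \<open>The product rule gives two terms of the same shape, with one factor differentiated in
  each. Hence the induction varies both maps at once and lowers the order of the factor left
  alone.\<close>

lemma Ck_map_bilinear:
  assumes "bounded_bilinear B"
  shows "Ck_map n f \<Longrightarrow> Ck_map n g \<Longrightarrow> Ck_map n (\<lambda>x. B (f x) (g x))"
proof (induction n arbitrary: f g)
  case 0
  then show ?case by (auto intro: bounded_bilinear.continuous_on assms)
next
  case (Suc n)
  show ?case
  proof (rule Ck_map_SucI[where f' = "\<lambda>x v. B (f x) (frechet_derivative g (at x) v) +
      B (frechet_derivative f (at x) v) (g x)"])
    show "((\<lambda>x. B (f x) (g x)) has_derivative (\<lambda>v. B (f x) (frechet_derivative g (at x) v) +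
      B (frechet_derivative f (at x) v) (g x))) (at x)" for x
      by (rule bounded_bilinear.FDERIV[OF assms Ck_map_Suc_has_derivative[OF Suc.prems(1)]
          Ck_map_Suc_has_derivative[OF Suc.prems(2)]])
    show "Ck_map n (\<lambda>x. B (f x) (frechet_derivative g (at x) v) +
      B (frechet_derivative f (at x) v) (g x))" for v
      using Suc.prems by (intro Ck_map_add Suc.IH) (auto intro: Ck_map_Suc_imp_Ck_map)
  qed
qed

lemma Ck_map_compose_affine:
  fixes f :: "'b::euclidean_space \<Rightarrow> 'c::real_normed_vector" and A :: "'a::euclidean_space \<Rightarrow> 'b"
  assumes "bounded_linear A"
  shows "Ck_map n f \<Longrightarrow> Ck_map n (\<lambda>x. f (A x + c))"
proof (induction n arbitrary: f)
  case 0
  then show ?case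
    by (auto intro!: continuous_on_compose2[of UNIV f] continuous_intros
        bounded_linear.continuous_on[OF assms])
next
  case (Suc n)
  show ?case
  proof (rule Ck_map_SucI[where f' = "\<lambda>x v. frechet_derivative f (at (A x + c)) (A v)"])
    show "((\<lambda>x. f (A x + c)) has_derivative
        (\<lambda>v. frechet_derivative f (at (A x + c)) (A v))) (at x)" for x
    proof (rule has_derivative_compose[OF _ Ck_map_Suc_has_derivative[OF Suc.prems]])
      show "((\<lambda>x. A x + c) has_derivative A) (at x)"
        by (rule has_derivative_add_const[OF bounded_linear_imp_has_derivative[OF assms]])
    qed
    show "Ck_map n (\<lambda>x. frechet_derivative f (at (A x + c)) (A v))" for v
      using Suc.prems by (intro Suc.IH) simp
  qed
qed

lemma Ck_map_compose_bounded_linear: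
  assumes "bounded_linear A" "Ck_map n f"
  shows "Ck_map n (\<lambda>x. f (A x))"
  using Ck_map_compose_affine[OF assms, of 0] by simp

lemma bounded_linear_axis: "bounded_linear (axis j :: 'b::real_normed_vector \<Rightarrow> 'b^'k::finite)"
proof (rule bounded_linear_intro[where K = 1])
  show "norm (axis j x :: 'b^'k) \<le> norm x * 1" for x
    by (simp add: norm_vec_def axis_def if_distrib[of norm] L2_set_def
        if_distrib[of "\<lambda>x. x^2"] cong: if_cong)
qed (auto simp: vec_eq_iff axis_def)

lemma Ck_map_vec_lambda:
  assumes "\<And>j. Ck_map n (\<lambda>x. g j x)"
  shows "Ck_map n (\<lambda>x. (\<chi> j. g j x) :: 'b::real_normed_vector^'k::finite)"
proof -
  have "(\<chi> j. g j x) = (\<Sum>j\<in>UNIV. axis j (g j x))" for x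
    by (simp add: vec_eq_iff axis_def)
  then show ?thesis
    by (simp only:) (intro Ck_map_sum Ck_map_compose_linear[OF bounded_linear_axis] assms)
qed

lemma Ck_map_Pair:
  assumes "Ck_map n f" "Ck_map n g"
  shows "Ck_map n (\<lambda>x. (f x, g x))"
proof -
  have "Ck_map n (\<lambda>x. (f x, 0) + (0, g x))"
    by (intro Ck_map_add Ck_map_compose_linear[of "\<lambda>y. (y, 0)"] Ck_map_compose_linear[of "\<lambda>y. (0, y)"]
        assms bounded_linear_Pair bounded_linear_ident bounded_linear_zero)
  then show ?thesis by simp
qed

text \<open>Differentiation only multiplies by a constant, so the induction closes on the same
  function.\<close>

lemma Ck_map_cis: "Ck_map n (\<lambda>s. cis (c * s))"
proof (induction n)
  case 0
  then show ?case by (auto intro!: continuous_intros)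
next
  case (Suc n)
  show ?case
  proof (rule Ck_map_SucI[where f' = "\<lambda>s v. (of_real (v * c) * \<i>) * cis (c * s)"])
    show "((\<lambda>s. cis (c * s)) has_derivative (\<lambda>v. (of_real (v * c) * \<i>) * cis (c * s))) (at s)" for s
      by (auto intro!: derivative_eq_intros simp: scaleR_conv_of_real mult_ac)
    show "Ck_map n (\<lambda>s. of_real (v * c) * \<i> * cis (c * s))" for v
      by (rule Ck_map_compose_linear[OF bounded_linear_mult_right Suc])
  qed
qed

lemma smooth_mapI: "(\<And>n. Ck_map n f) \<Longrightarrow> smooth_map f"
  by (simp add: smooth_map_def)

lemma smooth_map_has_derivative:
  "smooth_map f \<Longrightarrow> (f has_derivative frechet_derivative f (at x)) (at x)"
  using Ck_map_Suc_has_derivative smooth_map_def by blast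

lemma smooth_map_continuous: "smooth_map f \<Longrightarrow> continuous_on UNIV f"
  unfolding smooth_map_def by (metis Ck_map.simps(1))

lemma smooth_map_continuous_frechet_derivative:
  "smooth_map f \<Longrightarrow> continuous_on UNIV (\<lambda>x. frechet_derivative f (at x) v)"
  unfolding smooth_map_def by (metis Ck_map.simps)

section \<open>Compact supports and integrability\<close>

lemma compactly_supportedI:
  fixes f :: "'a::heine_borel \<Rightarrow> 'b::zero"
  assumes "compact K" "\<And>x. x \<notin> K \<Longrightarrow> f x = 0"
  shows "compactly_supported f"
proof -
  have "{x. f x \<noteq> 0} \<subseteq> K" using assms(2) by auto
  then show ?thesis
    unfolding compactly_supported_def using assms(1)
    by (meson bounded_subset compact_closure compact_imp_bounded)
qed

lemma compactly_supportedE: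
  assumes "compactly_supported f"
  obtains K where "compact K" "\<And>x. x \<notin> K \<Longrightarrow> f x = 0"
  using assms unfolding compactly_supported_def by (metis (mono_tags, lifting) closure_subset mem_Collect_eq subsetD)

text \<open>The complement of \<open>K\<close> is open, so \<open>f\<close> agrees with 0 on a
  neighbourhood of \<open>x\<close>.\<close>

lemma compact_support_frechet_derivative:
  fixes f :: "'a::euclidean_space \<Rightarrow> 'b::real_normed_vector"
  assumes "compact K" "\<And>x. x \<notin> K \<Longrightarrow> f x = 0" "x \<notin> K"
  shows "frechet_derivative f (at x) = (\<lambda>v. 0)"
proof -
  have "open (- K)" using assms(1) by (simp add: compact_imp_closed open_Compl)
  then have "(f has_derivative (\<lambda>v. 0)) (at x)"
    by (rule has_derivative_transform_within_open[OF has_derivative_const[of 0]])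
       (use assms in auto)
  then show ?thesis using frechet_derivative_at by metis
qed

lemma integrable_continuous_compact_support:
  fixes f :: "'a::euclidean_space \<Rightarrow> real"
  assumes "compact K" "continuous_on UNIV f" "\<And>x. x \<notin> K \<Longrightarrow> f x = 0"
  shows "integrable lborel f"
proof -
  have "integrable lborel (\<lambda>x. indicator K x *\<^sub>R f x)"
    using assms by (intro borel_integrable_compact) (auto intro: continuous_on_subset)
  moreover have "(\<lambda>x. indicator K x *\<^sub>R f x) = f"
    using assms(3) by (intro ext) (auto simp: indicator_def)
  ultimately show ?thesis by simp
qed

section \<open>A smooth bump function\<close>

text \<open>The polynomial factor makes this family closed under differentiation.\<close>

definition flat :: "real poly \<Rightarrow> real \<Rightarrow> real" where
  "flat p x = (if x > 0 then poly p (1 / x) * exp (- (1 / x)) else 0)"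

lemma tendsto_poly_times_exp_minus: "((\<lambda>z::real. poly p z * exp (- z)) \<longlongrightarrow> 0) at_top"
proof -
  have "((\<lambda>z::real. \<Sum>i\<le>degree p. coeff p i * (z ^ i / exp z)) \<longlongrightarrow> (\<Sum>i\<le>degree p. coeff p i * 0)) at_top"
    by (intro tendsto_intros tendsto_power_div_exp_0)
  then show ?thesis
    by (simp add: poly_altdef exp_minus sum_distrib_right divide_inverse mult.assoc)
qed

text \<open>With z = 1/x one has d/dx = - z^2 d/dz, which turns p(z) exp(-z) into z^2 (p - p')(z)
  exp(-z); \<open>[:0, 0, 1:]\<close> is z^2. At 0 the exponential beats every power of z.\<close>

lemma flat_has_real_derivative:
  "(flat p has_real_derivative flat ([:0, 0, 1:] * (p - pderiv p)) x) (at x)"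
proof -
  consider "x > 0" | "x < 0" | "x = 0" by linarith
  then show ?thesis
  proof cases
    case 1
    have "((\<lambda>x. poly p (1 / x) * exp (- (1 / x))) has_real_derivative
        flat ([:0, 0, 1:] * (p - pderiv p)) x) (at x)"
      using 1 by (auto intro!: derivative_eq_intros simp: flat_def field_simps power2_eq_square)
    then show ?thesis
      by (rule has_field_derivative_transform_within_open[of _ _ _ "{0<..}"])
         (use 1 in \<open>auto simp: flat_def\<close>)
  next
    case 2
    have "((\<lambda>x. 0) has_real_derivative flat ([:0, 0, 1:] * (p - pderiv p)) x) (at x)"
      using 2 by (auto simp: flat_def)
    then show ?thesis
      by (rule has_field_derivative_transform_within_open[of _ _ _ "{..<0}"])
         (use 2 in \<open>auto simp: flat_def\<close>)
  next
    case 3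
    have R: "((\<lambda>y. flat p y / y) \<longlongrightarrow> 0) (at_right 0)"
    proof -
      \<comment> \<open>Dividing by \<open>y\<close> multiplies the polynomial in 1/y by its
        variable, hence \<open>pCons 0 p\<close>.\<close>
      have "((\<lambda>y::real. poly (pCons 0 p) (inverse y) * exp (- inverse y)) \<longlongrightarrow> 0) (at_right 0)"
        by (rule filterlim_compose[OF tendsto_poly_times_exp_minus filterlim_inverse_at_top_right])
      then show ?thesis
        by (rule Lim_transform_eventually)
           (auto simp: eventually_at_filter flat_def divide_inverse)
    qed
    have L: "((\<lambda>y. flat p y / y) \<longlongrightarrow> 0) (at_left 0)"
      by (rule Lim_transform_eventually[of "\<lambda>_. 0"]) (auto simp: eventually_at_filter flat_def)
    show ?thesis
      using R L 3 by (simp add: has_field_derivative_iff filterlim_split_at flat_def)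
  qed
qed

lemma Ck_map_flat: "Ck_map n (flat p)"
proof (induction n arbitrary: p)
  case 0
  show ?case
    using flat_has_real_derivative DERIV_continuous continuous_at_imp_continuous_on
    by (metis Ck_map.simps(1))
next
  case (Suc n)
  show ?case
  proof (rule Ck_map_SucI)
    show "(flat p has_derivative (\<lambda>v. v * flat ([:0, 0, 1:] * (p - pderiv p)) x)) (at x)" for x
      using flat_has_real_derivative[of p x]
      by (simp add: has_field_derivative_def mult_commute_abs)
    show "Ck_map n (\<lambda>x. v * flat ([:0, 0, 1:] * (p - pderiv p)) x)" for v
      by (rule Ck_map_compose_linear[OF bounded_linear_mult_right Suc])
  qed
qed

text \<open>On the open unit interval this is exp(-1/x - 1/(1-x)). The support has length one so
  that distinct integer translates meet at most in an endpoint.\<close>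

definition bump :: "real \<Rightarrow> real" where
  "bump x = flat 1 x * flat 1 (1 - x)"

lemma bump_eq_0: "x \<notin> {0<..<1} \<Longrightarrow> bump x = 0"
  by (auto simp: bump_def flat_def)

lemma bump_pos: "x \<in> {0<..<1} \<Longrightarrow> bump x > 0"
  by (auto simp: bump_def flat_def)

lemma Ck_map_bump: "Ck_map n bump"
proof -
  have "Ck_map n (\<lambda>x. flat 1 x * flat 1 (- x + 1))"
    by (intro Ck_map_bilinear[OF bounded_bilinear_mult] Ck_map_flat
        Ck_map_compose_affine bounded_linear_minus bounded_linear_ident)
  then show ?thesis by (simp add: bump_def[abs_def])
qed

definition bump' :: "real \<Rightarrow> real" where
  "bump' x = frechet_derivative bump (at x) 1"

lemma bump_has_real_derivative: "(bump has_real_derivative bump' x) (at x)"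
proof -
  have "(bump has_derivative frechet_derivative bump (at x)) (at x)"
    using Ck_map_Suc_has_derivative[OF Ck_map_bump[of "Suc 0"]] .
  moreover have "frechet_derivative bump (at x) = (\<lambda>v. bump' x * v)"
  proof
    fix v
    show "frechet_derivative bump (at x) v = bump' x * v"
      using linear_scale[OF has_derivative_linear[OF calculation], of v 1]
      by (simp add: bump'_def mult.commute)
  qed
  ultimately show ?thesis by (simp add: has_field_derivative_def)
qed

text \<open>Outside the open interval, endpoints included, one factor vanishes together with its
  derivative. This gives \<open>bump'\<close> the same disjoint translates as
  \<open>bump\<close>.\<close>

lemma bump'_eq_0:
  assumes "x \<notin> {0<..<1}"
  shows "bump' x = 0"
proof -
  have "(bump has_real_derivative 0) (at x)"
    unfolding bump_def[abs_def]
    by (rule derivative_eq_intros flat_has_real_derivative[THEN DERIV_chain2] flat_has_real_derivative refl)+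
       (use assms in \<open>auto simp: flat_def\<close>)
  then show ?thesis
    using bump_has_real_derivative DERIV_unique by blast
qed

lemma continuous_bump': "continuous_on UNIV bump'"
  unfolding bump'_def[abs_def] using Ck_map_bump[of "Suc 0"] by simp

lemma continuous_bump: "continuous_on UNIV bump"
  using Ck_map_bump[of 0] by simp

lemma integral_bump_squared_pos: "0 < (\<integral>x. (bump x)\<^sup>2 \<partial>lborel)"
proof -
  have int: "integrable lborel (\<lambda>x. (bump x)\<^sup>2)"
    by (rule integrable_continuous_compact_support[of "{0..1}"])
       (auto intro!: continuous_intros continuous_bump bump_eq_0)
  have "(\<integral>x. (bump x)\<^sup>2 \<partial>lborel) \<noteq> 0"
  proof
    assume "(\<integral>x. (bump x)\<^sup>2 \<partial>lborel) = 0"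
    then have "AE x in lborel. (bump x)\<^sup>2 = 0"
      using integral_nonneg_eq_0_iff_AE[OF int] by simp
    \<comment> \<open>Positivity of \<open>bump\<close> would make the unit interval a null
      set.\<close>
    then have "AE x in lborel. x \<notin> {0<..<1::real}"
      by (rule eventually_mono) (use bump_pos in force)
    then have "emeasure lborel {0<..<1::real} = 0"
      by (subst (asm) AE_iff_measurable[of "{0<..<1}"]) auto
    then show False by simp
  qed
  then show ?thesis
    by (simp add: less_le)
qed

section \<open>Second variation in an orthonormal frame\<close>

text \<open>The vector of partial derivatives represents \<open>g'\<close> through the inner
  product. Such a vector is unique, so it is the one that \<open>grad\<close> describes.\<close>

lemma norm_grad_squared:
  fixes g :: "real^'k \<Rightarrow> real"
  assumes "(g has_derivative g') (at u)"
  shows "(norm (grad g u))\<^sup>2 = (\<Sum>m\<in>UNIV. (g' (axis m 1))\<^sup>2)"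
proof -
  interpret linear g' using assms by (rule has_derivative_linear)
  define D :: "real^'k" where "D = (\<chi> m. g' (axis m 1))"
  have g': "g' v = v \<bullet> D" for v
  proof -
    have "g' v = g' (\<Sum>m\<in>UNIV. (v $ m) *s axis m 1)"
      by (simp only: basis_expansion)
    also have "\<dots> = v \<bullet> D"
      by (simp add: sum scalar_mult_eq_scaleR scaleR inner_vec_def D_def)
    finally show ?thesis .
  qed
  have "grad g u = D"
    unfolding grad_def
  proof (rule the_equality)
    show "GDERIV g u :> D"
      using assms unfolding gderiv_def g'[abs_def] by simp
    fix E assume "GDERIV g u :> E"
    then have "(\<lambda>v. v \<bullet> E) = (\<lambda>v. v \<bullet> D)"
      using assms has_derivative_unique unfolding gderiv_def g'[abs_def] by blast
    then show "E = D"
      using vector_eq_ldot[of E D] by (simp add: fun_eq_iff)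
  qed
  then show ?thesis
    by (simp add: D_def power2_norm_eq_inner inner_vec_def) (simp add: power2_eq_square)
qed

lemma norm_squared_eq_sum_Basis: "(norm z)\<^sup>2 = (\<Sum>d\<in>Basis. (z \<bullet> d)\<^sup>2)"
  by (simp add: power2_norm_eq_inner euclidean_inner[of z z]) (simp add: power2_eq_square)

text \<open>The Hilbert-Schmidt norm does not depend on the orthonormal basis: pass to the adjoint,
  swap the sums and apply Parseval in both bases.\<close>

lemma sum_norm_squared_orthonormal_basis:
  fixes T :: "'a::euclidean_space \<Rightarrow> 'c::euclidean_space"
  assumes "linear T" "span C = UNIV" "\<And>x y. x \<in> C \<Longrightarrow> y \<in> C \<Longrightarrow> x \<bullet> y = (if x = y then 1 else 0)"
  shows "(\<Sum>x\<in>C. (norm (T x))\<^sup>2) = (\<Sum>e\<in>Basis. (norm (T e))\<^sup>2)"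
proof -
  have fin: "finite C"
    by (rule pairwise_orthogonal_imp_finite) (auto simp: pairwise_def orthogonal_def assms(3))
  have parseval: "(\<Sum>x\<in>C. (x \<bullet> z)\<^sup>2) = (norm z)\<^sup>2" for z
  proof -
    have "z = (\<Sum>x\<in>C. (z \<bullet> x) *\<^sub>R x)"
      using assms(2,3) fin
      by (intro orthonormal_basis_expand[symmetric]) (auto simp: pairwise_def orthogonal_def norm_eq_1)
    then have "z \<bullet> z = z \<bullet> (\<Sum>x\<in>C. (z \<bullet> x) *\<^sub>R x)" by simp
    then show ?thesis
      by (simp add: inner_sum_right power2_norm_eq_inner) (simp add: power2_eq_square inner_commute)
  qed
  have "(\<Sum>x\<in>C. (norm (T x))\<^sup>2) = (\<Sum>x\<in>C. \<Sum>d\<in>Basis. (x \<bullet> adjoint T d)\<^sup>2)"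
    by (simp add: adjoint_works[OF assms(1)] norm_squared_eq_sum_Basis)
  also have "\<dots> = (\<Sum>d\<in>Basis. \<Sum>x\<in>C. (x \<bullet> adjoint T d)\<^sup>2)"
    by (rule sum.swap)
  also have "\<dots> = (\<Sum>d\<in>Basis. \<Sum>e\<in>Basis. (e \<bullet> adjoint T d)\<^sup>2)"
    by (simp add: parseval norm_squared_eq_sum_Basis inner_commute)
  also have "\<dots> = (\<Sum>e\<in>Basis. \<Sum>d\<in>Basis. (e \<bullet> adjoint T d)\<^sup>2)"
    by (rule sum.swap)
  also have "\<dots> = (\<Sum>e\<in>Basis. (norm (T e))\<^sup>2)"
    by (simp add: adjoint_works[OF assms(1)] norm_squared_eq_sum_Basis)
  finally show ?thesis .
qed

section \<open>Normal projection and change of orthonormal frame\<close>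

context
  fixes F :: "'a::euclidean_space \<Rightarrow> 'b::euclidean_space" and x :: 'a
  assumes lin: "linear (frechet_derivative F (at x))"
begin

lemma subspace_tangent_space: "subspace (tangent_space F x)"
  unfolding tangent_space_def using lin linear_subspace_image subspace_UNIV by blast

lemma subspace_normal_space: "subspace (normal_space F x)"
  unfolding normal_space_def by (rule subspace_orthogonal_comp)

lemma normal_tangent_eq_0: "n \<in> normal_space F x \<Longrightarrow> t \<in> tangent_space F x \<Longrightarrow> t \<bullet> n = 0"
  by (auto simp: normal_space_def orthogonal_comp_def orthogonal_def)

text \<open>The difference of two candidates is both normal and tangent, hence orthogonal to
  itself.\<close>

lemma normal_proj_eqI:
  assumes "n \<in> normal_space F x" "w - n \<in> tangent_space F x"
  shows "normal_proj F x w = n"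
  unfolding normal_proj_def
proof (rule the_equality)
  fix m assume m: "m \<in> normal_space F x \<and> w - m \<in> tangent_space F x"
  have "m - n \<in> normal_space F x"
    using m assms by (simp add: subspace_diff[OF subspace_normal_space])
  moreover have "(w - n) - (w - m) \<in> tangent_space F x"
    by (rule subspace_diff[OF subspace_tangent_space]) (use m assms in auto)
  ultimately have "(m - n) \<bullet> (m - n) = 0"
    using normal_tangent_eq_0 by force
  then show "m = n" by simp
qed (use assms in simp)

lemma normal_proj_works:
  "normal_proj F x w \<in> normal_space F x" "w - normal_proj F x w \<in> tangent_space F x"
proof -
  obtain y z where "y \<in> span (tangent_space F x)" "w = y + z"
    and "\<And>t. t \<in> span (tangent_space F x) \<Longrightarrow> orthogonal z t"
    using orthogonal_subspace_decomp_exists[of "tangent_space F x" w] by metis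
  then have "z \<in> normal_space F x" "w - z \<in> tangent_space F x"
    by (auto simp: normal_space_def orthogonal_comp_def span_base orthogonal_commute
        span_eq_iff[THEN iffD2, OF subspace_tangent_space])
  then show "normal_proj F x w \<in> normal_space F x" "w - normal_proj F x w \<in> tangent_space F x"
    using normal_proj_eqI by auto
qed

lemma linear_normal_proj: "linear (normal_proj F x)"
proof (rule linearI)
  show "normal_proj F x (v + w) = normal_proj F x v + normal_proj F x w" for v w
  proof (rule normal_proj_eqI)
    show "v + w - (normal_proj F x v + normal_proj F x w) \<in> tangent_space F x"
      using subspace_add[OF subspace_tangent_space normal_proj_works(2)[of v] normal_proj_works(2)[of w]]
      by (simp add: algebra_simps)
  qed (intro subspace_add[OF subspace_normal_space] normal_proj_works)
  show "normal_proj F x (c *\<^sub>R v) = c *\<^sub>R normal_proj F x v" for c v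
  proof (rule normal_proj_eqI)
    show "c *\<^sub>R v - c *\<^sub>R normal_proj F x v \<in> tangent_space F x"
      using subspace_scale[OF subspace_tangent_space normal_proj_works(2)[of v], of c]
      by (simp add: algebra_simps)
  qed (intro subspace_scale[OF subspace_normal_space] normal_proj_works)
qed

lemma inner_normal_proj:
  assumes "n \<in> normal_space F x"
  shows "normal_proj F x w \<bullet> n = w \<bullet> n"
  using normal_tangent_eq_0[OF assms normal_proj_works(2)[of w]] by (simp add: inner_diff_left)

context
  fixes A :: "'a \<Rightarrow> 'a"
  assumes linA: "linear A"
    and iso: "\<And>v w. frechet_derivative F (at x) (A v) \<bullet> frechet_derivative F (at x) (A w) = v \<bullet> w"
begin

lemma bij_frame_map: "bij A"
proof -
  have "inj A"
  proof (rule injI)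
    fix v w assume "A v = A w"
    then have "z \<bullet> v = z \<bullet> w" for z
      using iso[of z v] iso[of z w] by simp
    then show "v = w"
      using vector_eq_ldot by blast
  qed
  then show ?thesis
    using linA linear_injective_imp_surjective by (auto simp: bij_def)
qed

lemma orthonormal_frame_image_Basis: "orthonormal_frame F x (A ` Basis)"
proof -
  have "span (A ` Basis) = A ` span Basis"
    by (rule linear_span_image[OF linA])
  then show ?thesis
    using bij_frame_map iso by (auto simp: orthonormal_frame_def bij_def inner_Basis dest: injD)
qed

text \<open>\<open>A\<close> is an isometry from the Euclidean inner product to the metric induced
  by \<open>F\<close>. It pulls a frame back to an orthonormal basis of the parameter space, where
  independence of the basis is known.\<close>

lemma sum_orthonormal_frame:
  fixes T :: "'a \<Rightarrow> 'c::euclidean_space"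
  assumes B: "orthonormal_frame F x B" and T: "linear T"
  shows "(\<Sum>b\<in>B. (norm (T b))\<^sup>2) = (\<Sum>e\<in>Basis. (norm (T (A e)))\<^sup>2)"
proof -
  define C where "C = A -` B"
  have B_eq: "B = A ` C"
    using bij_frame_map by (simp add: C_def bij_def surj_image_vimage_eq)
  have inj: "inj A" using bij_frame_map by (simp add: bij_def)
  have "A ` span C = UNIV"
    using B by (simp add: orthonormal_frame_def B_eq linear_span_image[OF linA])
  then have span: "span C = UNIV"
    using inj bij_frame_map inj_image_eq_iff[of A "span C" UNIV] by (simp add: bij_def)
  have "(\<Sum>b\<in>B. (norm (T b))\<^sup>2) = (\<Sum>c\<in>C. (norm ((T \<circ> A) c))\<^sup>2)"
    unfolding B_eq by (subst sum.reindex) (use inj in \<open>auto intro: inj_on_subset\<close>)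
  also have "\<dots> = (\<Sum>e\<in>Basis. (norm ((T \<circ> A) e))\<^sup>2)"
  proof (rule sum_norm_squared_orthonormal_basis)
    show "linear (T \<circ> A)" using linA T by (rule linear_compose)
    show "v \<bullet> w = (if v = w then 1 else 0)" if "v \<in> C" "w \<in> C" for v w
    proof -
      have "A v \<in> B" "A w \<in> B" using that by (auto simp: C_def)
      then have "frechet_derivative F (at x) (A v) \<bullet> frechet_derivative F (at x) (A w)
          = (if A v = A w then 1 else 0)"
        using B by (auto simp: orthonormal_frame_def)
      then show ?thesis using iso inj by (simp add: inj_eq)
    qed
  qed (rule span)
  finally show ?thesis by simp
qed

lemma second_variation_density_frame:
  assumes V: "linear (frechet_derivative V (at x))"
    and S: "\<And>v w. second_fundamental_form F x v w \<bullet> V x = S v w"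
    and S1: "\<And>w. linear (\<lambda>v. S v w)" and S2: "\<And>v. linear (S v)"
  shows "second_variation_density F V x =
    (\<Sum>e\<in>Basis. (norm (normal_connection F V x (A e)))\<^sup>2) -
    (\<Sum>d\<in>Basis. \<Sum>e\<in>Basis. (S (A d) (A e))\<^sup>2)"
proof -
  define B where "B = (SOME B. orthonormal_frame F x B)"
  have B: "orthonormal_frame F x B"
    unfolding B_def using orthonormal_frame_image_Basis by (rule someI)
  have "linear (normal_connection F V x)"
    unfolding normal_connection_def[abs_def]
    using linear_compose[OF V linear_normal_proj] by (simp add: comp_def)
  note 1 = sum_orthonormal_frame[OF B this]
  \<comment> \<open>\<open>S\<close> is linear in each slot, so the double sum changes frame one
    slot at a time.\<close>
  have S1': "(\<Sum>b\<in>B. (S b w)\<^sup>2) = (\<Sum>e\<in>Basis. (S (A e) w)\<^sup>2)" for w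
    using sum_orthonormal_frame[OF B S1[of w]] by simp
  have S2': "(\<Sum>b\<in>B. (S v b)\<^sup>2) = (\<Sum>e\<in>Basis. (S v (A e))\<^sup>2)" for v
    using sum_orthonormal_frame[OF B S2[of v]] by simp
  have "(\<Sum>a\<in>B. \<Sum>b\<in>B. (S a b)\<^sup>2) = (\<Sum>a\<in>B. \<Sum>e\<in>Basis. (S a (A e))\<^sup>2)"
    by (simp only: S2')
  also have "\<dots> = (\<Sum>e\<in>Basis. \<Sum>a\<in>B. (S a (A e))\<^sup>2)"
    by (rule sum.swap)
  also have "\<dots> = (\<Sum>e\<in>Basis. \<Sum>d\<in>Basis. (S (A d) (A e))\<^sup>2)"
    by (simp only: S1')
  also have "\<dots> = (\<Sum>d\<in>Basis. \<Sum>e\<in>Basis. (S (A d) (A e))\<^sup>2)"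
    by (rule sum.swap)
  finally show ?thesis
    unfolding second_variation_density_def Let_def B_def[symmetric] S 1 by (simp only:)
qed

end

end

text \<open>The Gram matrix is diagonal, and every permutation other than the identity picks an
  off-diagonal entry, so a single term of the Leibniz formula survives.\<close>

lemma volume_density_orthogonal:
  assumes "\<And>b c. b \<in> Basis \<Longrightarrow> c \<in> Basis \<Longrightarrow> b \<noteq> c \<Longrightarrow>
    frechet_derivative F (at x) b \<bullet> frechet_derivative F (at x) c = 0"
  shows "volume_density F x = sqrt (\<Prod>b\<in>Basis. (norm (frechet_derivative F (at x) b))\<^sup>2)"
proof -
  let ?G = "\<lambda>b c. frechet_derivative F (at x) b \<bullet> frechet_derivative F (at x) c"
  have "(\<Sum>p | p permutes Basis. of_int (sign p) * (\<Prod>b\<in>Basis. ?G b (p b))) =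
      (\<Sum>p\<in>{id}. of_int (sign p) * (\<Prod>b\<in>Basis. ?G b (p b)))"
  proof (rule sum.mono_neutral_right)
    show "\<forall>p\<in>{p. p permutes Basis} - {id}. of_int (sign p) * (\<Prod>b\<in>Basis. ?G b (p b)) = 0"
    proof
      fix p assume p: "p \<in> {p. p permutes (Basis :: 'a set)} - {id}"
      then obtain b where "p b \<noteq> b" by (auto simp: fun_eq_iff)
      then have "b \<in> Basis" "p b \<in> Basis"
        using p permutes_not_in permutes_in_image by fastforce+
      then have "(\<Prod>b\<in>Basis. ?G b (p b)) = 0"
        using assms[of b "p b"] \<open>p b \<noteq> b\<close> by (intro prod_zero) auto
      then show "of_int (sign p) * (\<Prod>b\<in>Basis. ?G b (p b)) = 0" by simp
    qed
  qed (auto simp: permutes_id finite_permutations)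
  then show ?thesis
    by (simp add: volume_density_def power2_norm_eq_inner)
qed

section \<open>The second variation density of the helicoid\<close>

text \<open>
  Coordinates relative to the rotating vectors \<open>e^(i l\<^sub>j s)\<close>, \<open>i e^(i l\<^sub>j s)\<close> and the axis: in them
  inner products no longer depend on \<open>s\<close>, the tangent space is spanned by \<open>p\<close> and \<open>(0, l * u, 1)\<close>, and
  normal vectors have \<open>p = 0\<close>.
\<close>

definition twist :: "real^'k::finite \<Rightarrow> real \<Rightarrow> real^'k \<Rightarrow> real^'k \<Rightarrow> real \<Rightarrow> (complex^'k) \<times> real" where
  "twist l s p q r = (\<chi> j. cis (l $ j * s) * Complex (p $ j) (q $ j), r)"

lemma inner_cis_mult: "(cis t * z) \<bullet> (cis t * w) = z \<bullet> w"
proof -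
  have "(cis t * z) \<bullet> (cis t * w) = ((cos t)\<^sup>2 + (sin t)\<^sup>2) * (Re z * Re w + Im z * Im w)"
    unfolding inner_complex_def times_complex.sel cis.sel by algebra
  then show ?thesis by (simp add: inner_complex_def)
qed

lemma inner_twist: "twist l s p q r \<bullet> twist l s p' q' r' = p \<bullet> p' + q \<bullet> q' + r * r'"
  by (simp add: twist_def inner_vec_def inner_cis_mult) (simp add: inner_complex_def sum.distrib)

lemma diff_twist: "twist l s p q r - twist l s p' q' r' = twist l s (p - p') (q - q') (r - r')"
  by (simp add: twist_def vec_eq_iff right_diff_distrib[symmetric] complex_diff)

lemma twistE: obtains p q r where "w = twist l s p q r"
proof
  show "w = twist l s (\<chi> j. Re (cis (- (l $ j * s)) * fst w $ j))
      (\<chi> j. Im (cis (- (l $ j * s)) * fst w $ j)) (snd w)"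
    unfolding twist_def
    by (simp only: vec_eq_iff prod_eq_iff vec_lambda_beta fst_conv snd_conv complex_surj mult.assoc[symmetric] cis_mult) simp
qed

lemma has_derivative_vec_lambda:
  fixes g :: "'k::finite \<Rightarrow> 'a::real_normed_vector \<Rightarrow> 'b::real_normed_vector"
  assumes "\<And>j. (g j has_derivative g' j) F"
  shows "((\<lambda>x. \<chi> j. g j x) has_derivative (\<lambda>v. \<chi> j. g' j v)) F"
proof -
  have *: "(\<chi> j. f j) = (\<Sum>j\<in>UNIV. axis j (f j))" for f :: "'k \<Rightarrow> 'b"
    by (simp add: vec_eq_iff axis_def)
  show ?thesis
    unfolding * by (intro has_derivative_sum bounded_linear.has_derivative[OF bounded_linear_axis] assms)
qed

lemma bounded_linear_mult_vec: "bounded_linear (\<lambda>x. l * x :: real^'k::finite)"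
  by (intro linear_conv_bounded_linear[THEN iffD1] linearI) (simp_all add: vec_eq_iff algebra_simps)

text \<open>Differentiating the rotation multiplies the entry j by i \<open>l $ j\<close>, and
  multiplication by i sends the pair (p, q) to (-q, p). Products of real vectors such as
  \<open>l * p x\<close> are componentwise.\<close>

lemma has_derivative_twist:
  assumes "(p has_derivative p') (at x)" "(q has_derivative q') (at x)" "(r has_derivative r') (at x)"
  shows "((\<lambda>x. twist l (snd x) (p x) (q x) (r x)) has_derivative
     (\<lambda>v. twist l (snd x) (p' v - snd v *\<^sub>R (l * q x)) (q' v + snd v *\<^sub>R (l * p x)) (r' v))) (at x)"
proof -
  have "((\<lambda>x. cis (l $ j * snd x) * Complex (p x $ j) (q x $ j)) has_derivative
     (\<lambda>v. cis (l $ j * snd x) * Complex ((p' v - snd v *\<^sub>R (l * q x)) $ j) ((q' v + snd v *\<^sub>R (l * p x)) $ j)))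
     (at x)" for j
  proof -
    have "((\<lambda>x. p x $ j) has_derivative (\<lambda>v. p' v $ j)) (at x)"
      "((\<lambda>x. q x $ j) has_derivative (\<lambda>v. q' v $ j)) (at x)"
      using assms(1,2) by (auto intro: bounded_linear.has_derivative[OF bounded_linear_vec_nth])
    note [derivative_intros] = this
    show ?thesis
      unfolding Complex_eq
      by (rule derivative_eq_intros refl)+
         (auto simp: fun_eq_iff complex_eq_iff algebra_simps)
  qed
  then show ?thesis
    unfolding twist_def by (intro has_derivative_Pair has_derivative_vec_lambda assms(3))
qed

section \<open>The helicoid, its derivatives and its normal spaces\<close>

lemma inner_mult_vec_assoc: "(l * a) \<bullet> b = (a :: real^'k::finite) \<bullet> (l * b)"
  by (simp add: inner_vec_def mult_ac)

lemma helicoid_h_squared: "(helicoid_h l u)\<^sup>2 = 1 + (l * u) \<bullet> (l * u)"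
  by (simp add: helicoid_h_def inner_vec_def sum_nonneg add_nonneg_nonneg) (simp add: power2_eq_square)

lemma helicoid_h_pos: "helicoid_h l u > 0"
  by (simp add: helicoid_h_def sum_nonneg add_pos_nonneg)

lemma helicoid_eq_twist: "helicoid l x = twist l (snd x) (fst x) 0 (snd x)"
  by (cases x) (simp add: helicoid_def twist_def cis_conv_exp vec_eq_iff mult_ac complex_of_real_def[symmetric])

lemma frechet_derivative_helicoid:
  "frechet_derivative (helicoid l) (at x) = (\<lambda>v. twist l (snd x) (fst v) (snd v *\<^sub>R (l * fst x)) (snd v))"
proof -
  have "(helicoid l has_derivative
      (\<lambda>v. twist l (snd x) (fst v - snd v *\<^sub>R (l * 0)) (0 + snd v *\<^sub>R (l * fst x)) (snd v))) (at x)"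
    unfolding helicoid_eq_twist[abs_def]
    by (intro has_derivative_twist derivative_intros)
  then show ?thesis
    by (intro frechet_derivative_at[symmetric]) (simp add: vec_eq_iff)
qed

lemma frechet_derivative_helicoid_twice:
  "frechet_derivative (\<lambda>y. frechet_derivative (helicoid l) (at y) w) (at x) =
    (\<lambda>v. twist l (snd x) (- snd v *\<^sub>R (l * (snd w *\<^sub>R (l * fst x))))
      (snd w *\<^sub>R (l * fst v) + snd v *\<^sub>R (l * fst w)) 0)"
proof -
  have "((\<lambda>y. twist l (snd y) (fst w) (snd w *\<^sub>R (l * fst y)) (snd w)) has_derivative
    (\<lambda>v. twist l (snd x) (0 - snd v *\<^sub>R (l * (snd w *\<^sub>R (l * fst x))))
      (snd w *\<^sub>R (l * fst v) + snd v *\<^sub>R (l * fst w)) 0)) (at x)"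
    by (intro has_derivative_twist derivative_intros bounded_linear.has_derivative[OF bounded_linear_mult_vec])
  then show ?thesis
    unfolding frechet_derivative_helicoid
    by (intro frechet_derivative_at[symmetric]) simp
qed

lemma linear_frechet_derivative_helicoid: "linear (frechet_derivative (helicoid l) (at x))"
  unfolding frechet_derivative_helicoid
  by (rule linearI) (simp_all add: twist_def vec_eq_iff complex_eq_iff algebra_simps)

lemma twist_mem_normal_space_iff:
  "twist l (snd x) p q r \<in> normal_space (helicoid l) x \<longleftrightarrow> p = 0 \<and> r = - ((l * fst x) \<bullet> q)"
proof -
  have "twist l (snd x) p q r \<in> normal_space (helicoid l) x \<longleftrightarrow>
      (\<forall>v t. v \<bullet> p + t * ((l * fst x) \<bullet> q + r) = 0)"
    by (auto simp: normal_space_def tangent_space_def orthogonal_comp_def orthogonal_def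
        frechet_derivative_helicoid inner_twist algebra_simps)
  also have "\<dots> \<longleftrightarrow> p = 0 \<and> r = - ((l * fst x) \<bullet> q)"
  proof
    assume *: "\<forall>v t. v \<bullet> p + t * ((l * fst x) \<bullet> q + r) = 0"
    \<comment> \<open>Testing with \<open>v = p\<close> gives |p|^2 = 0; testing with
      \<open>t = 1\<close> gives the other equation.\<close>
    show "p = 0 \<and> r = - ((l * fst x) \<bullet> q)"
      using *[rule_format, of p 0] *[rule_format, of 0 1] by simp
  qed auto
  finally show ?thesis .
qed

text \<open>The part \<open>p\<close> is tangent and drops out. From (q, r) the projection removes
  the component along the tangent direction (\<open>l * fst x\<close>, 1), whose squared length is
  h^2; the formula is Pythagoras.\<close>

lemma norm_squared_normal_proj_helicoid:
  "(norm (normal_proj (helicoid l) x (twist l (snd x) p q r)))\<^sup>2 =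
    q \<bullet> q + r\<^sup>2 - ((l * fst x) \<bullet> q + r)\<^sup>2 / (helicoid_h l (fst x))\<^sup>2"
proof -
  define h where "h = helicoid_h l (fst x)"
  define b where "b = l * fst x"
  \<comment> \<open>The coefficient of the orthogonal projection of (q, r) to the line through (b,
    1).\<close>
  define c where "c = (b \<bullet> q + r) / h\<^sup>2"
  have h: "h\<^sup>2 = 1 + b \<bullet> b" "h\<^sup>2 \<noteq> 0"
    using helicoid_h_squared helicoid_h_pos[of l "fst x"] by (auto simp: h_def b_def)
  then have c: "c + c * (b \<bullet> b) = b \<bullet> q + r"
    using distrib_left[of c 1 "b \<bullet> b"] unfolding h(1)[symmetric] by (simp add: c_def)
  have "normal_proj (helicoid l) x (twist l (snd x) p q r) = twist l (snd x) 0 (q - c *\<^sub>R b) (r - c)"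
  proof (rule normal_proj_eqI[OF linear_frechet_derivative_helicoid])
    show "twist l (snd x) 0 (q - c *\<^sub>R b) (r - c) \<in> normal_space (helicoid l) x"
      using c unfolding twist_mem_normal_space_iff b_def[symmetric]
      by (simp add: inner_diff_right)
    have "twist l (snd x) p q r - twist l (snd x) 0 (q - c *\<^sub>R b) (r - c) =
        frechet_derivative (helicoid l) (at x) (p, c)"
      by (simp add: diff_twist frechet_derivative_helicoid b_def)
    then show "twist l (snd x) p q r - twist l (snd x) 0 (q - c *\<^sub>R b) (r - c) \<in> tangent_space (helicoid l) x"
      by (simp add: tangent_space_def)
  qed
  then have "(norm (normal_proj (helicoid l) x (twist l (snd x) p q r)))\<^sup>2 =
      q \<bullet> q + r\<^sup>2 - 2 * c * (b \<bullet> q + r) + c * (c + c * (b \<bullet> b))"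
    by (simp add: power2_norm_eq_inner inner_twist) (simp add: algebra_simps inner_commute power2_eq_square)
  also have "\<dots> = q \<bullet> q + r\<^sup>2 - (b \<bullet> q + r)\<^sup>2 / h\<^sup>2"
    unfolding c by (simp add: c_def power2_eq_square algebra_simps)
  finally show ?thesis by (simp add: h_def b_def)
qed

section \<open>Normal fields described by coefficient maps\<close>

definition helicoid_normal_field :: "real^'k::finite \<Rightarrow> ((real^'k) \<times> real \<Rightarrow> real^'k) \<Rightarrow> (real^'k) \<times> real \<Rightarrow> (complex^'k) \<times> real"
  where "helicoid_normal_field l a x = twist l (snd x) 0 (a x) (- ((l * fst x) \<bullet> a x))"

lemma helicoid_normal_field_mem: "helicoid_normal_field l a x \<in> normal_space (helicoid l) x"
  by (simp add: helicoid_normal_field_def twist_mem_normal_space_iff)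

lemma helicoid_normal_field_has_derivative:
  assumes "(a has_derivative a') (at x)"
  shows "(helicoid_normal_field l a has_derivative
    (\<lambda>v. twist l (snd x) (- snd v *\<^sub>R (l * a x)) (a' v) (- ((l * fst x) \<bullet> a' v + (l * fst v) \<bullet> a x)))) (at x)"
proof -
  have "((\<lambda>x. twist l (snd x) 0 (a x) (- ((l * fst x) \<bullet> a x))) has_derivative
    (\<lambda>v. twist l (snd x) (0 - snd v *\<^sub>R (l * a x)) (a' v + snd v *\<^sub>R (l * 0)) (- ((l * fst x) \<bullet> a' v + (l * fst v) \<bullet> a x)))) (at x)"
    by (intro has_derivative_twist derivative_intros bounded_linear.has_derivative[OF bounded_linear_mult_vec] assms)
  then show ?thesis
    by (simp add: helicoid_normal_field_def[abs_def])
qed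

section \<open>Volume and second variation densities in coordinates\<close>

lemma Basis_vec_real: "(Basis :: ((real^'k::finite) \<times> real) set) = insert (0, 1) (range (\<lambda>m. (axis m 1, 0)))"
  by (auto simp: Basis_prod_def Basis_vec_def)

lemma sum_Basis_vec_real:
  fixes g :: "(real^'k::finite) \<times> real \<Rightarrow> 'c::comm_monoid_add"
  shows "sum g Basis = (\<Sum>m\<in>UNIV. g (axis m 1, 0)) + g (0, 1)"
  unfolding Basis_vec_real
  by (subst sum.insert) (auto simp: sum.reindex inj_on_def axis_eq_axis add.commute)

lemma prod_Basis_vec_real:
  fixes g :: "(real^'k::finite) \<times> real \<Rightarrow> 'c::comm_monoid_mult"
  shows "prod g Basis = (\<Prod>m\<in>UNIV. g (axis m 1, 0)) * g (0, 1)"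
  unfolding Basis_vec_real
  by (subst prod.insert) (auto simp: prod.reindex inj_on_def axis_eq_axis mult.commute)

text \<open>The coordinate directions are mapped to orthogonal vectors of length 1, except the last,
  which gets length h.\<close>

lemma volume_density_helicoid:
  fixes l :: "real^'k::finite"
  shows "volume_density (helicoid l) x = helicoid_h l (fst x)"
proof -
  have "volume_density (helicoid l) x =
      sqrt (\<Prod>b\<in>Basis. (norm (frechet_derivative (helicoid l) (at x) b))\<^sup>2)"
  proof (rule volume_density_orthogonal)
    fix b c :: "(real^'k) \<times> real"
    assume "b \<in> Basis" "c \<in> Basis" "b \<noteq> c"
    then show "frechet_derivative (helicoid l) (at x) b \<bullet> frechet_derivative (helicoid l) (at x) c = 0"
      by (auto simp: frechet_derivative_helicoid inner_twist Basis_prod_def inner_Basis split: if_splits)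
  qed
  also have "\<dots> = sqrt ((helicoid_h l (fst x))\<^sup>2)"
    by (simp add: prod_Basis_vec_real frechet_derivative_helicoid power2_norm_eq_inner inner_twist
        inner_axis_axis helicoid_h_squared)
  finally show ?thesis
    using helicoid_h_pos[of l "fst x"] by simp
qed

text \<open>The integrand of \<open>helicoid_q\<close> as a function of position \<open>u\<close>,
  value \<open>y\<close> and derivative \<open>y'\<close> of the test map. The square in the sum is
  that of the m-th partial derivative of the inner product of \<open>l * u\<close> and the map,
  expanded by the product rule. Values and derivatives are separate arguments so that slices of a
  map on the whole parameter space fit too.\<close>

definition q_integrand :: "real^'k::finite \<Rightarrow> real^'k \<Rightarrow> real^'k \<Rightarrow> (real^'k \<Rightarrow> real^'k) \<Rightarrow> real" where
  "q_integrand l u y y' = helicoid_h l u *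
     ((\<Sum>m\<in>UNIV. y' (axis m 1) \<bullet> y' (axis m 1) + ((l * u) \<bullet> y' (axis m 1) + l $ m * y $ m)\<^sup>2)
       - 3 * ((l * y) \<bullet> (l * y)) / (helicoid_h l u)\<^sup>2)"

text \<open>The energy of the derivative \<open>z\<close> in the direction \<open>s\<close>: the
  unit frame vector contributes h^-2 and the volume density h.\<close>

definition s_integrand :: "real^'k::finite \<Rightarrow> real^'k \<Rightarrow> real^'k \<Rightarrow> real" where
  "s_integrand l u z = (z \<bullet> z + ((l * u) \<bullet> z)\<^sup>2) / helicoid_h l u"

lemma inner_mult_axis: "(l * axis m 1) \<bullet> y = l $ m * (y :: real^'k::finite) $ m"
  unfolding inner_mult_vec_assoc by (simp add: inner_axis')

text \<open>The factor 3 in \<open>q\<close> arises as 1 + 2: one |l * a|^2 / h^2 is lost when the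
  derivative of the field is projected to the normal space, and two come from the second fundamental
  form.\<close>

lemma second_variation_density_helicoid:
  fixes l :: "real^'k::finite"
  assumes a: "(a has_derivative a') (at x)"
  shows "second_variation_density (helicoid l) (helicoid_normal_field l a) x * volume_density (helicoid l) x =
    q_integrand l (fst x) (a x) (\<lambda>v. a' (v, 0)) + s_integrand l (fst x) (a' (0, 1))"
proof -
  define h where "h = helicoid_h l (fst x)"
  \<comment> \<open>The coordinate frame is already orthogonal; only the direction \<open>s\<close>,
    of length h, has to be rescaled.\<close>
  define A where "A v = (fst v, snd v / h)" for v :: "(real^'k) \<times> real"
  define S where "S v w = (snd w *\<^sub>R (l * fst v) + snd v *\<^sub>R (l * fst w)) \<bullet> a x"
    for v w :: "(real^'k) \<times> real"
  have h: "h\<^sup>2 = 1 + (l * fst x) \<bullet> (l * fst x)" "h > 0"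
    using helicoid_h_squared helicoid_h_pos by (auto simp: h_def)
  interpret a': linear a' using a by (rule has_derivative_linear)
  have V': "frechet_derivative (helicoid_normal_field l a) (at x) =
     (\<lambda>v. twist l (snd x) (- snd v *\<^sub>R (l * a x)) (a' v) (- ((l * fst x) \<bullet> a' v + (l * fst v) \<bullet> a x)))"
    using helicoid_normal_field_has_derivative[OF a] by (rule frechet_derivative_at[symmetric])
  have D: "second_variation_density (helicoid l) (helicoid_normal_field l a) x =
    (\<Sum>e\<in>Basis. (norm (normal_connection (helicoid l) (helicoid_normal_field l a) x (A e)))\<^sup>2) -
    (\<Sum>d\<in>Basis. \<Sum>e\<in>Basis. (S (A d) (A e))\<^sup>2)"
  proof (rule second_variation_density_frame[OF linear_frechet_derivative_helicoid])
    show "linear A"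
      by (rule linearI) (simp_all add: A_def add_divide_distrib)
    show "frechet_derivative (helicoid l) (at x) (A v) \<bullet> frechet_derivative (helicoid l) (at x) (A w) = v \<bullet> w"
      for v w
    proof -
      have "frechet_derivative (helicoid l) (at x) (A v) \<bullet> frechet_derivative (helicoid l) (at x) (A w) =
          fst v \<bullet> fst w + (snd v * snd w / h\<^sup>2) * (1 + (l * fst x) \<bullet> (l * fst x))"
        by (simp add: frechet_derivative_helicoid inner_twist A_def power2_eq_square algebra_simps)
      also have "\<dots> = v \<bullet> w"
        using h by (simp add: inner_prod_def flip: h(1))
      finally show ?thesis .
    qed
    show "linear (frechet_derivative (helicoid_normal_field l a) (at x))"
      unfolding V' using helicoid_normal_field_has_derivative[OF a] by (rule has_derivative_linear)
    \<comment> \<open>Pairing with a normal vector makes the projection invisible, so the second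
      derivative of the parametrization suffices.\<close>
    show "second_fundamental_form (helicoid l) x v w \<bullet> helicoid_normal_field l a x = S v w" for v w
      unfolding second_fundamental_form_def
        inner_normal_proj[OF linear_frechet_derivative_helicoid helicoid_normal_field_mem]
      by (simp add: frechet_derivative_helicoid_twice helicoid_normal_field_def inner_twist S_def)
    show "linear (\<lambda>v. S v w)" for w
      by (rule linearI) (simp_all add: S_def algebra_simps inner_mult_vec_assoc)
    show "linear (S v)" for v
      by (rule linearI) (simp_all add: S_def algebra_simps inner_mult_vec_assoc)
  qed
  \<comment> \<open>In the tangential component the two occurrences of \<open>a' v\<close> cancel,
    and only the inner product of \<open>l * fst v\<close> with \<open>a x\<close> remains to be
    subtracted.\<close>
  have N: "(norm (normal_connection (helicoid l) (helicoid_normal_field l a) x v))\<^sup>2 =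
     a' v \<bullet> a' v + ((l * fst x) \<bullet> a' v + (l * fst v) \<bullet> a x)\<^sup>2 - ((l * fst v) \<bullet> a x)\<^sup>2 / h\<^sup>2" for v
    unfolding normal_connection_def V' norm_squared_normal_proj_helicoid
    by (simp add: h_def) (simp add: power2_eq_square algebra_simps)
  have T: "a' (0, 1 / h) = (1 / h) *\<^sub>R a' (0, 1)"
    using a'.scaleR[of "1 / h" "(0, 1)"] by simp
  have L: "(l * a x) \<bullet> (l * a x) = (\<Sum>m\<in>UNIV. (l $ m * a x $ m)\<^sup>2)"
    by (simp add: inner_vec_def power2_eq_square)
  have 1: "(\<Sum>e\<in>Basis. (norm (normal_connection (helicoid l) (helicoid_normal_field l a) x (A e)))\<^sup>2) =
     (\<Sum>m\<in>UNIV. a' (axis m 1, 0) \<bullet> a' (axis m 1, 0) + ((l * fst x) \<bullet> a' (axis m 1, 0) + l $ m * a x $ m)\<^sup>2)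
     - ((l * a x) \<bullet> (l * a x)) / h\<^sup>2 + (a' (0, 1) \<bullet> a' (0, 1) + ((l * fst x) \<bullet> a' (0, 1))\<^sup>2) / h\<^sup>2"
    unfolding sum_Basis_vec_real N L
    by (simp add: A_def T inner_mult_axis sum.distrib sum_subtractf sum_divide_distrib power_divide add_divide_distrib)
       (simp add: power2_eq_square)
  \<comment> \<open>\<open>S\<close> vanishes on pairs of directions in \<open>u\<close> and on the
    pair (s, s). Each mixed pair occurs in both orders, hence the 2.\<close>
  have 2: "(\<Sum>d\<in>Basis. \<Sum>e\<in>Basis. (S (A d) (A e))\<^sup>2) = 2 * ((l * a x) \<bullet> (l * a x)) / h\<^sup>2"
    unfolding sum_Basis_vec_real L
    by (simp add: S_def A_def inner_mult_axis power_divide sum_divide_distrib[symmetric])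
  show ?thesis
    unfolding D 1 2 volume_density_helicoid q_integrand_def s_integrand_def h_def[symmetric]
    using h(2) by (simp add: field_simps power2_eq_square)
qed

text \<open>The product rule handles the second gradient; in the first term the sums over components
  and over directions are swapped.\<close>

lemma helicoid_q_integrand:
  assumes f: "(f has_derivative f') (at u)"
  shows "helicoid_h l u *
        ((\<Sum>j\<in>UNIV. (norm (grad (\<lambda>v. f v $ j) u))\<^sup>2)
         + (norm (grad (\<lambda>v. \<Sum>j\<in>UNIV. l $ j * v $ j * f v $ j) u))\<^sup>2
         - 3 * (\<Sum>j\<in>UNIV. (l $ j * f u $ j)\<^sup>2) / (helicoid_h l u)\<^sup>2) = q_integrand l u (f u) f'"
proof -
  have 1: "(norm (grad (\<lambda>v. f v $ j) u))\<^sup>2 = (\<Sum>m\<in>UNIV. (f' (axis m 1) $ j)\<^sup>2)" for j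
    by (rule norm_grad_squared) (rule bounded_linear.has_derivative[OF bounded_linear_vec_nth f])
  have eq: "(\<lambda>v. \<Sum>j\<in>UNIV. l $ j * v $ j * f v $ j) = (\<lambda>v. (l * v) \<bullet> f v)"
    by (simp add: inner_vec_def)
  have "((\<lambda>v. (l * v) \<bullet> f v) has_derivative (\<lambda>v. (l * u) \<bullet> f' v + (l * v) \<bullet> f u)) (at u)"
    by (intro derivative_intros bounded_linear.has_derivative[OF bounded_linear_mult_vec] f)
  then have 2: "(norm (grad (\<lambda>v. \<Sum>j\<in>UNIV. l $ j * v $ j * f v $ j) u))\<^sup>2 =
      (\<Sum>m\<in>UNIV. ((l * u) \<bullet> f' (axis m 1) + l $ m * f u $ m)\<^sup>2)"
    by (subst eq, subst norm_grad_squared) (auto simp: inner_mult_axis)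
  have 3: "(\<Sum>j\<in>UNIV. \<Sum>m\<in>UNIV. (f' (axis m 1) $ j)\<^sup>2) = (\<Sum>m\<in>UNIV. f' (axis m 1) \<bullet> f' (axis m 1))"
    by (subst sum.swap) (simp add: inner_vec_def power2_eq_square)
  have 4: "(l * f u) \<bullet> (l * f u) = (\<Sum>m\<in>UNIV. (l $ m * f u $ m)\<^sup>2)"
    by (simp add: inner_vec_def power2_eq_square)
  show ?thesis
    unfolding 1 2 3 q_integrand_def 4 by (simp add: sum.distrib)
qed

lemma helicoid_q_eq:
  assumes "smooth_map f"
  shows "helicoid_q l f = (\<integral>u. q_integrand l u (f u) (frechet_derivative f (at u)) \<partial>lborel)"
  unfolding helicoid_q_def
  using helicoid_q_integrand[OF smooth_map_has_derivative[OF assms]] by simp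

section \<open>Stability and index\<close>

lemma continuous_on_helicoid_h: "continuous_on UNIV (helicoid_h l)"
  unfolding helicoid_h_def[abs_def] by (intro continuous_intros)

lemma helicoid_h_nonzero: "helicoid_h l u \<noteq> 0"
  using helicoid_h_pos[of l u] by simp

lemma integrable_q_integrand:
  assumes "smooth_map f" "compactly_supported f"
  shows "integrable lborel (\<lambda>u. q_integrand l u (f u) (frechet_derivative f (at u)))"
    and "continuous_on UNIV (\<lambda>u. q_integrand l u (f u) (frechet_derivative f (at u)))"
proof -
  obtain K where K: "compact K" "\<And>u. u \<notin> K \<Longrightarrow> f u = 0"
    using assms(2) by (metis compactly_supportedE)
  show *: "continuous_on UNIV (\<lambda>u. q_integrand l u (f u) (frechet_derivative f (at u)))"
    unfolding q_integrand_def
    by (intro continuous_intros smooth_map_continuous smooth_map_continuous_frechet_derivative assms(1)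
        bounded_linear.continuous_on[OF bounded_linear_mult_vec] continuous_on_helicoid_h)
       (simp add: helicoid_h_nonzero)
  show "integrable lborel (\<lambda>u. q_integrand l u (f u) (frechet_derivative f (at u)))"
  proof (rule integrable_continuous_compact_support[OF K(1) *])
    show "q_integrand l u (f u) (frechet_derivative f (at u)) = 0" if "u \<notin> K" for u
      using compact_support_frechet_derivative[OF K that] K(2)[OF that] by (simp add: q_integrand_def)
  qed
qed

lemma q_integrand_scale: "q_integrand l u (c *\<^sub>R y) (\<lambda>v. c *\<^sub>R y' v) = c\<^sup>2 * q_integrand l u y y'"
proof -
  have "(\<Sum>m\<in>UNIV. (c *\<^sub>R y' (axis m 1)) \<bullet> (c *\<^sub>R y' (axis m 1)) +
      ((l * u) \<bullet> (c *\<^sub>R y' (axis m 1)) + l $ m * (c *\<^sub>R y) $ m)\<^sup>2) =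
    c\<^sup>2 * (\<Sum>m\<in>UNIV. y' (axis m 1) \<bullet> y' (axis m 1) + ((l * u) \<bullet> y' (axis m 1) + l $ m * y $ m)\<^sup>2)"
    unfolding sum_distrib_left by (intro sum.cong refl) (simp add: power2_eq_square algebra_simps)
  moreover have "(l * (c *\<^sub>R y)) \<bullet> (l * (c *\<^sub>R y)) = c\<^sup>2 * ((l * y) \<bullet> (l * y))"
    by (simp add: power2_eq_square)
  ultimately show ?thesis
    unfolding q_integrand_def by (simp only:) (simp add: algebra_simps)
qed

lemma s_integrand_scale: "s_integrand l u (c *\<^sub>R z) = c\<^sup>2 * s_integrand l u z"
  by (simp add: s_integrand_def power2_eq_square algebra_simps)

lemma s_integrand_nonneg: "s_integrand l u z \<ge> 0"
  using helicoid_h_pos[of l u] by (simp add: s_integrand_def)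

lemma continuous_on_s_integrand:
  assumes "continuous_on UNIV f"
  shows "continuous_on UNIV (\<lambda>u. s_integrand l u (f u))"
  unfolding s_integrand_def
  by (intro continuous_intros assms bounded_linear.continuous_on[OF bounded_linear_mult_vec]
      continuous_on_helicoid_h) (simp_all add: helicoid_h_nonzero)

lemma second_variation_helicoid_normal_field:
  assumes "smooth_map a"
  shows "second_variation (helicoid l) (helicoid_normal_field l a) =
    (\<integral>x. q_integrand l (fst x) (a x) (\<lambda>v. frechet_derivative a (at x) (v, 0)) +
      s_integrand l (fst x) (frechet_derivative a (at x) (0, 1)) \<partial>lborel)"
  unfolding second_variation_def
    second_variation_density_helicoid[OF smooth_map_has_derivative[OF assms]] ..

section \<open>Normal fields correspond to smooth compactly supported coefficient maps\<close>

lemma Ck_map_cis_snd: "Ck_map n (\<lambda>x :: (real^'k::finite) \<times> real. cis (c * snd x))"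
  by (rule Ck_map_compose_bounded_linear[OF bounded_linear_snd Ck_map_cis])

lemma helicoid_normal_field_in_normal_fields:
  assumes "smooth_map a" "compactly_supported a"
  shows "helicoid_normal_field l a \<in> normal_fields (helicoid l)"
proof -
  have "Ck_map n (helicoid_normal_field l a)" for n
  proof -
    have a: "Ck_map n a" using assms(1) by (simp add: smooth_map_def)
    have "bounded_linear (\<lambda>x. l * fst x)"
      by (rule bounded_linear_compose[OF bounded_linear_mult_vec bounded_linear_fst])
    note b = Ck_map_bounded_linear[OF this, of n]
    have c: "Ck_map n (\<lambda>x. Complex 0 (a x $ j))" for j
    proof -
      have "bounded_linear (\<lambda>z :: real^'a. \<i> * complex_of_real (z $ j))"
        by (rule bounded_linear_compose[OF bounded_linear_mult_right
              bounded_linear_compose[OF bounded_linear_of_real bounded_linear_vec_nth]])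
      then show ?thesis
        using Ck_map_compose_linear[OF _ a] by (simp add: Complex_eq)
    qed
    have "Ck_map n (\<lambda>x. ((\<chi> j. cis (l $ j * snd x) * Complex 0 (a x $ j)), - ((l * fst x) \<bullet> a x)))"
      by (intro Ck_map_Pair Ck_map_vec_lambda Ck_map_bilinear[OF bounded_bilinear_mult]
          Ck_map_bilinear[OF bounded_bilinear_inner] Ck_map_cis_snd a b c
          Ck_map_compose_linear[OF bounded_linear_minus[OF bounded_linear_ident]])
    then show ?thesis
      by (simp add: helicoid_normal_field_def[abs_def] twist_def)
  qed
  moreover have "compactly_supported (helicoid_normal_field l a)"
  proof -
    obtain K where K: "compact K" "\<And>x. x \<notin> K \<Longrightarrow> a x = 0"
      using assms(2) by (metis compactly_supportedE)
    show ?thesis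
      by (rule compactly_supportedI[OF K(1)])
         (simp add: K(2) helicoid_normal_field_def twist_def vec_eq_iff prod_eq_iff Complex_eq_0)
  qed
  ultimately show ?thesis
    by (simp add: normal_fields_def smooth_mapI helicoid_normal_field_mem)
qed

text \<open>Rotating the field back and taking imaginary parts recovers the coefficient by a formula
  that is visibly smooth and vanishes wherever \<open>V\<close> does.\<close>

lemma normal_fields_helicoidE:
  assumes "V \<in> normal_fields (helicoid l)"
  obtains a where "smooth_map a" "compactly_supported a" "V = helicoid_normal_field l a"
proof
  define a where "a x = (\<chi> j. Im (cis (- l $ j * snd x) * fst (V x) $ j))" for x
  have V: "smooth_map V" "compactly_supported V" "\<And>x. V x \<in> normal_space (helicoid l) x"
    using assms by (auto simp: normal_fields_def)
  show "smooth_map a"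
  proof (rule smooth_mapI)
    fix n
    have "Ck_map n (\<lambda>x. fst (V x) $ j)" for j
      by (rule Ck_map_compose_linear[OF bounded_linear_compose[OF bounded_linear_vec_nth bounded_linear_fst]])
         (use V(1) in \<open>simp add: smooth_map_def\<close>)
    then show "Ck_map n a"
      unfolding a_def[abs_def]
      by (intro Ck_map_vec_lambda Ck_map_compose_linear[OF bounded_linear_Im]
          Ck_map_bilinear[OF bounded_bilinear_mult] Ck_map_cis_snd)
  qed
  obtain K where "compact K" "\<And>x. x \<notin> K \<Longrightarrow> V x = 0"
    using V(2) by (metis compactly_supportedE)
  then show "compactly_supported a"
    by (intro compactly_supportedI[of K]) (auto simp: a_def vec_eq_iff)
  show "V = helicoid_normal_field l a"
  proof
    fix x
    obtain p q r where w: "V x = twist l (snd x) p q r" by (rule twistE)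
    have p: "p = 0" "r = - ((l * fst x) \<bullet> q)"
      using V(3)[of x] unfolding w twist_mem_normal_space_iff by auto
    have "cis (- l $ j * snd x) * fst (V x) $ j = Complex (p $ j) (q $ j)" for j
      unfolding w twist_def by (simp add: mult.assoc[symmetric] cis_mult)
    then have "a x = q"
      by (simp add: a_def vec_eq_iff)
    then show "V x = helicoid_normal_field l a x"
      by (simp add: w p helicoid_normal_field_def)
  qed
qed

text \<open>For fixed \<open>s\<close> the slice of the coefficient map is a test map for
  \<open>q\<close>. Dropping the nonnegative \<open>s_integrand\<close> bounds the integral over
  \<open>u\<close> from below by \<open>helicoid_q\<close> of that slice; it remains to integrate
  over \<open>s\<close>.\<close>

lemma second_variation_helicoid_nonneg:
  assumes q: "\<And>f :: real^'k::finite \<Rightarrow> real^'k. smooth_map f \<Longrightarrow> compactly_supported f \<Longrightarrow> helicoid_q l f \<ge> 0"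
    and V: "V \<in> normal_fields (helicoid l)"
  shows "second_variation (helicoid l) V \<ge> 0"
proof -
  obtain a where a: "smooth_map a" "compactly_supported a" and Va: "V = helicoid_normal_field l a"
    using V by (rule normal_fields_helicoidE)
  define D where "D u s = q_integrand l u (a (u, s)) (\<lambda>v. frechet_derivative a (at (u, s)) (v, 0)) +
      s_integrand l u (frechet_derivative a (at (u, s)) (0, 1))" for u s
  have Q: "second_variation (helicoid l) V = integral\<^sup>L (lborel \<Otimes>\<^sub>M lborel) (\<lambda>(u, s). D u s)"
    unfolding Va second_variation_helicoid_normal_field[OF a(1)] lborel_prod
    by (simp add: D_def case_prod_unfold)
  have inner_nonneg: "(\<integral>u. D u s \<partial>lborel) \<ge> 0" for s
  proof -
    define f where "f u = a (u, s)" for u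
    have f_eq: "f = (\<lambda>u. a ((u, 0) + (0, s)))" by (simp add: f_def fun_eq_iff)
    have f: "smooth_map f"
      unfolding f_eq using a(1)
      by (intro smooth_mapI Ck_map_compose_affine bounded_linear_Pair bounded_linear_ident bounded_linear_zero)
         (simp add: smooth_map_def)
    obtain K where "compact K" "\<And>x. x \<notin> K \<Longrightarrow> a x = 0"
      using a(2) by (metis compactly_supportedE)
    then have cf: "compactly_supported f"
      by (intro compactly_supportedI[of "fst ` K"] compact_continuous_image continuous_intros)
         (force simp: f_def)+
    have f': "frechet_derivative f (at u) = (\<lambda>v. frechet_derivative a (at (u, s)) (v, 0))" for u
    proof (rule frechet_derivative_at[symmetric])
      show "(f has_derivative (\<lambda>v. frechet_derivative a (at (u, s)) (v, 0))) (at u)"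
        unfolding f_def
        by (rule has_derivative_compose[of "\<lambda>u. (u, s)" "\<lambda>v. (v, 0)", OF _ smooth_map_has_derivative[OF a(1)]])
           (intro derivative_intros)
    qed
    \<comment> \<open>A function that is not integrable has integral 0 by convention, so that case
      satisfies the inequality as well. The same device serves for the double integral.\<close>
    show ?thesis
    proof (cases "integrable lborel (\<lambda>u. D u s)")
      case True
      have "helicoid_q l f \<le> (\<integral>u. D u s \<partial>lborel)"
        unfolding helicoid_q_eq[OF f]
        by (rule integral_mono[OF integrable_q_integrand(1)[OF f cf] True])
           (simp add: D_def f' f_def s_integrand_nonneg)
      then show ?thesis using q[OF f cf] by simp
    qed (simp add: not_integrable_integral_eq)
  qed
  show ?thesis
  proof (cases "integrable (lborel \<Otimes>\<^sub>M lborel) (\<lambda>(u, s). D u s)")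
    case True
    show ?thesis
      unfolding Q using lborel_pair.integral_snd[OF True] inner_nonneg
      by (metis (no_types, lifting) Bochner_Integration.integral_nonneg)
  qed (simp add: Q not_integrable_integral_eq)
qed

section \<open>Fields with separated variables\<close>

lemma integral_lborel_product:
  fixes G :: "'a::euclidean_space \<Rightarrow> real" and g :: "'b::euclidean_space \<Rightarrow> real"
  assumes "continuous_on UNIV G" "compact K" "\<And>x. x \<notin> K \<Longrightarrow> G x = 0"
    and "continuous_on UNIV g" "compact L" "\<And>x. x \<notin> L \<Longrightarrow> g x = 0"
  shows "integrable lborel (\<lambda>x. g (snd x) * G (fst x))"
    and "(\<integral>x. g (snd x) * G (fst x) \<partial>lborel) = (\<integral>s. g s \<partial>lborel) * (\<integral>u. G u \<partial>lborel)"
proof -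
  show *: "integrable lborel (\<lambda>x. g (snd x) * G (fst x))"
  proof (rule integrable_continuous_compact_support[of "K \<times> L"])
    show "continuous_on UNIV (\<lambda>x. g (snd x) * G (fst x))"
      by (intro continuous_intros continuous_on_compose2[OF assms(1)] continuous_on_compose2[OF assms(4)]) auto
    show "g (snd x) * G (fst x) = 0" if "x \<notin> K \<times> L" for x
      using that assms(3)[of "fst x"] assms(6)[of "snd x"] by (cases x) auto
  qed (intro compact_Times assms)
  then have "integrable (lborel \<Otimes>\<^sub>M lborel) (\<lambda>(u, s). g s * G u)"
    by (simp add: lborel_prod case_prod_unfold)
  from lborel_pair.integral_fst[OF this]
  show "(\<integral>x. g (snd x) * G (fst x) \<partial>lborel) = (\<integral>s. g s \<partial>lborel) * (\<integral>u. G u \<partial>lborel)"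
    by (simp add: lborel_prod case_prod_unfold)
qed

text \<open>Derivatives along \<open>u\<close> carry the factor \<phi> and the derivative along
  \<open>s\<close> the factor \<phi>'. Both integrands are homogeneous of degree 2, so these factors
  come out squared and Fubini separates the integrals.\<close>

lemma second_variation_product:
  fixes f :: "real^'k::finite \<Rightarrow> real^'k"
  assumes f: "smooth_map f" "compactly_supported f"
    and \<phi>: "smooth_map \<phi>" "compactly_supported \<phi>"
  defines "a \<equiv> (\<lambda>x. \<phi> (snd x) *\<^sub>R f (fst x))"
  shows "helicoid_normal_field l a \<in> normal_fields (helicoid l)"
    and "second_variation (helicoid l) (helicoid_normal_field l a) =
      (\<integral>s. (\<phi> s)\<^sup>2 \<partial>lborel) * helicoid_q l f +
      (\<integral>s. (frechet_derivative \<phi> (at s) 1)\<^sup>2 \<partial>lborel) * (\<integral>u. s_integrand l u (f u) \<partial>lborel)"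
proof -
  obtain K where K: "compact K" "\<And>x. x \<notin> K \<Longrightarrow> f x = 0"
    using f(2) by (metis compactly_supportedE)
  obtain L where L: "compact L" "\<And>x. x \<notin> L \<Longrightarrow> \<phi> x = 0"
    using \<phi>(2) by (metis compactly_supportedE)
  have a: "smooth_map a"
    unfolding a_def using f(1) \<phi>(1)
    by (intro smooth_mapI Ck_map_bilinear[OF bounded_bilinear_scaleR]
        Ck_map_compose_bounded_linear[OF bounded_linear_snd] Ck_map_compose_bounded_linear[OF bounded_linear_fst])
       (auto simp: smooth_map_def)
  have "compactly_supported a"
  proof (rule compactly_supportedI)
    show "compact (K \<times> L)" by (rule compact_Times[OF K(1) L(1)])
    show "a x = 0" if "x \<notin> K \<times> L" for x
      using that K(2)[of "fst x"] L(2)[of "snd x"] by (cases x) (auto simp: a_def)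
  qed
  with a show "helicoid_normal_field l a \<in> normal_fields (helicoid l)"
    by (rule helicoid_normal_field_in_normal_fields)
  have a': "frechet_derivative a (at x) = (\<lambda>v. \<phi> (snd x) *\<^sub>R frechet_derivative f (at (fst x)) (fst v) +
      frechet_derivative \<phi> (at (snd x)) (snd v) *\<^sub>R f (fst x))" for x
    unfolding a_def
    by (rule frechet_derivative_at[symmetric])
       (intro has_derivative_scaleR has_derivative_compose[OF _ smooth_map_has_derivative] derivative_intros f \<phi>)
  \<comment> \<open>Evaluating the derivative of \<open>a\<close> at (v, 0) and (0, 1) leaves terms
    with a derivative applied to 0.\<close>
  have zero: "frechet_derivative f (at u) 0 = 0" "frechet_derivative \<phi> (at s) 0 = 0" for u s
    using linear_0[OF has_derivative_linear[OF smooth_map_has_derivative[OF f(1)]]]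
      linear_0[OF has_derivative_linear[OF smooth_map_has_derivative[OF \<phi>(1)]]] by auto
  note 1 = integral_lborel_product[OF integrable_q_integrand(2)[OF f, of l] K(1) _ _ L(1), of "\<lambda>s. (\<phi> s)\<^sup>2"]
  note 2 = integral_lborel_product[OF continuous_on_s_integrand[OF smooth_map_continuous[OF f(1)], of l] K(1) _ _ L(1),
      of "\<lambda>s. (frechet_derivative \<phi> (at s) 1)\<^sup>2"]
  have cont: "continuous_on UNIV (\<lambda>s. (\<phi> s)\<^sup>2)" "continuous_on UNIV (\<lambda>s. (frechet_derivative \<phi> (at s) 1)\<^sup>2)"
    by (rule continuous_on_power, rule smooth_map_continuous smooth_map_continuous_frechet_derivative, rule \<phi>)+
  have supp: "(\<phi> s)\<^sup>2 = 0" "(frechet_derivative \<phi> (at s) 1)\<^sup>2 = 0" if "s \<notin> L" for s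
    using L(2)[OF that] compact_support_frechet_derivative[OF L that] by simp_all
  have supp': "q_integrand l u (f u) (frechet_derivative f (at u)) = 0" "s_integrand l u (f u) = 0" if "u \<notin> K" for u
    using K(2)[OF that] compact_support_frechet_derivative[OF K that] by (simp_all add: q_integrand_def s_integrand_def)
  have "second_variation (helicoid l) (helicoid_normal_field l a) =
    (\<integral>x. (\<phi> (snd x))\<^sup>2 * q_integrand l (fst x) (f (fst x)) (frechet_derivative f (at (fst x))) +
      (frechet_derivative \<phi> (at (snd x)) 1)\<^sup>2 * s_integrand l (fst x) (f (fst x)) \<partial>lborel)"
    unfolding second_variation_helicoid_normal_field[OF a] a'
    by (simp add: a_def zero q_integrand_scale s_integrand_scale)
  then show "second_variation (helicoid l) (helicoid_normal_field l a) =
      (\<integral>s. (\<phi> s)\<^sup>2 \<partial>lborel) * helicoid_q l f +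
      (\<integral>s. (frechet_derivative \<phi> (at s) 1)\<^sup>2 \<partial>lborel) * (\<integral>u. s_integrand l u (f u) \<partial>lborel)"
    using 1[OF supp'(1) cont(1) supp(1)] 2[OF supp'(2) cont(2) supp(2)] by (simp add: helicoid_q_eq[OF f(1)])
qed

section \<open>Stretched translates of the bump with disjoint supports\<close>

definition bump_sum :: "real \<Rightarrow> nat \<Rightarrow> (nat \<Rightarrow> real) \<Rightarrow> real \<Rightarrow> real" where
  "bump_sum R n c s = (\<Sum>i<n. c i * bump (s / R - real i))"

text \<open>The translates are nonzero only on the disjoint intervals (i, i + 1), so all cross terms
  vanish. Stated for a general \<open>b\<close> to cover both \<open>bump\<close> and
  \<open>bump'\<close>.\<close>

lemma disjoint_translates_square:
  fixes b :: "real \<Rightarrow> real"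
  assumes "\<And>x. x \<notin> {0<..<1} \<Longrightarrow> b x = 0"
  shows "(\<Sum>i<n. c i * b (x - real i))\<^sup>2 = (\<Sum>i<n. (c i)\<^sup>2 * (b (x - real i))\<^sup>2)"
proof -
  have *: "b (x - real i) * b (x - real j) = 0" if "i \<noteq> j" for i j
  proof (rule ccontr)
    assume "b (x - real i) * b (x - real j) \<noteq> 0"
    then have "x - real i \<in> {0<..<1}" "x - real j \<in> {0<..<1}"
      using assms by fastforce+
    then show False using that by auto
  qed
  have "(\<Sum>i<n. c i * b (x - real i))\<^sup>2 = (\<Sum>i<n. \<Sum>j<n. c i * c j * (b (x - real i) * b (x - real j)))"
    by (simp add: power2_eq_square sum_product mult_ac)
  also have "\<dots> = (\<Sum>i<n. \<Sum>j<n. if j = i then (c i)\<^sup>2 * (b (x - real i))\<^sup>2 else 0)"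
    using * by (intro sum.cong refl) (auto simp: power2_eq_square)
  finally show ?thesis by simp
qed

text \<open>Without cross terms, the substitution t = s/R - i gives every summand the same integral,
  with Jacobian \<open>R\<close>.\<close>

lemma integral_disjoint_translates_square:
  fixes b :: "real \<Rightarrow> real"
  assumes b: "\<And>x. x \<notin> {0<..<1} \<Longrightarrow> b x = 0" and cont: "continuous_on UNIV b" and R: "R > 0"
  shows "(\<integral>s. (\<Sum>i<n. c i * b (s / R - real i))\<^sup>2 \<partial>lborel) = (\<Sum>i<n. (c i)\<^sup>2) * (R * (\<integral>s. (b s)\<^sup>2 \<partial>lborel))"
proof -
  have int: "integrable lborel (\<lambda>s. (b s)\<^sup>2)"
    by (rule integrable_continuous_compact_support[of "{0..1}"])
       (use b in \<open>auto intro!: continuous_intros cont\<close>)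
  have sq: "(\<Sum>i<n. c i * b (s / R - real i))\<^sup>2 = (\<Sum>i<n. (c i)\<^sup>2 * (b (s / R - real i))\<^sup>2)" for s
    by (rule disjoint_translates_square) (rule b)
  have int_i: "integrable lborel (\<lambda>s. (b (s / R - real i))\<^sup>2)" for i
    using lborel_integrable_real_affine[OF int, of "1 / R" "- real i"] R by (simp add: add.commute)
  have "(\<integral>s. (\<Sum>i<n. c i * b (s / R - real i))\<^sup>2 \<partial>lborel) =
      (\<Sum>i<n. (c i)\<^sup>2 * (\<integral>s. (b (s / R - real i))\<^sup>2 \<partial>lborel))"
    unfolding sq by (subst Bochner_Integration.integral_sum) (auto intro: int_i)
  also have "\<dots> = (\<Sum>i<n. (c i)\<^sup>2 * (R * (\<integral>s. (b s)\<^sup>2 \<partial>lborel)))"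
  proof (intro sum.cong refl)
    fix i
    show "(c i)\<^sup>2 * (\<integral>s. (b (s / R - real i))\<^sup>2 \<partial>lborel) = (c i)\<^sup>2 * (R * (\<integral>s. (b s)\<^sup>2 \<partial>lborel))"
      using lborel_integral_real_affine[of "1 / R" "\<lambda>s. (b s)\<^sup>2" "- real i"] R by (simp add: field_simps)
  qed
  finally show ?thesis by (simp only: sum_distrib_right)
qed

lemma bump_sum_smooth: "smooth_map (bump_sum R n c)"
proof (rule smooth_mapI)
  fix m
  have "Ck_map m (\<lambda>s. c i * bump ((1 / R) * s + - real i))" for i
    by (intro Ck_map_compose_linear[OF bounded_linear_mult_right] Ck_map_compose_affine
        bounded_linear_mult_right Ck_map_bump)
  then show "Ck_map m (bump_sum R n c)"
    unfolding bump_sum_def[abs_def] by (intro Ck_map_sum) simp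
qed

lemma bump_sum_compactly_supported:
  assumes "R > 0"
  shows "compactly_supported (bump_sum R n c)"
proof (rule compactly_supportedI[of "{0..R * real n}"])
  fix s assume s: "s \<notin> {0..R * real n}"
  have "bump (s / R - real i) = 0" if "i < n" for i
  proof (rule bump_eq_0, rule notI)
    assume "s / R - real i \<in> {0<..<1}"
    then have "0 < s / R" "s / R < real (Suc i)" by auto
    moreover have "real (Suc i) \<le> real n" using that by linarith
    ultimately have "0 < s / R" "s / R < real n" by linarith+
    then show False
      using s assms by (auto simp: field_simps zero_less_divide_iff)
  qed
  then show "bump_sum R n c s = 0" by (simp add: bump_sum_def)
qed simp

lemma frechet_derivative_bump_sum:
  assumes "R > 0"
  shows "frechet_derivative (bump_sum R n c) (at s) 1 = (\<Sum>i<n. (c i / R) * bump' (s / R - real i))"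
proof -
  have "(bump_sum R n c has_real_derivative (\<Sum>i<n. c i * (bump' (s / R - real i) * (1 / R)))) (at s)"
    unfolding bump_sum_def[abs_def]
    by (intro DERIV_sum DERIV_cmult DERIV_chain2[OF bump_has_real_derivative])
       (use assms in \<open>auto intro!: derivative_eq_intros\<close>)
  then show ?thesis
    using frechet_derivative_at[of "bump_sum R n c" _ s]
    by (auto simp: has_field_derivative_def fun_eq_iff dest!: frechet_derivative_at)
qed

text \<open>The fields \<open>E i\<close> have disjoint supports in \<open>s\<close> and equal
  energy \<kappa>, so the second variation is diagonal on their combinations.\<close>

lemma helicoid_negative_fields:
  fixes f :: "real^'k::finite \<Rightarrow> real^'k"
  assumes f: "smooth_map f" "compactly_supported f" and neg: "helicoid_q l f < 0"
  shows "\<exists>(E :: nat \<Rightarrow> (real^'k) \<times> real \<Rightarrow> (complex^'k) \<times> real) \<kappa>. \<kappa> < 0 \<and>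
    (\<forall>n c. (\<lambda>x. \<Sum>i<n. c i *\<^sub>R E i x) \<in> normal_fields (helicoid l)) \<and>
    (\<forall>n c. second_variation (helicoid l) (\<lambda>x. \<Sum>i<n. c i *\<^sub>R E i x) = (\<Sum>i<n. (c i)\<^sup>2) * \<kappa>)"
proof -
  define b where "b = (\<integral>s. (bump s)\<^sup>2 \<partial>lborel)"
  define b' where "b' = (\<integral>s. (bump' s)\<^sup>2 \<partial>lborel)"
  define P where "P = (\<integral>u. s_integrand l u (f u) \<partial>lborel)"
  \<comment> \<open>Negativity of \<kappa> means b' P < R^2 b (-q). Since R \<ge> 1 it suffices that
    b' P < R b (-q), and this choice makes the right-hand side equal to b (-q) + b' P.\<close>
  define R where "R = 1 + b' * P / (b * - helicoid_q l f)"
  define \<kappa> where "\<kappa> = R * b * helicoid_q l f + b' / R * P"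
  define E where "E i = helicoid_normal_field l (\<lambda>x. bump (snd x / R - real i) *\<^sub>R f (fst x))" for i
  have b: "b > 0" unfolding b_def by (rule integral_bump_squared_pos)
  have P: "b' * P \<ge> 0" by (simp add: b'_def P_def s_integrand_nonneg)
  have bq: "b * - helicoid_q l f > 0" using b neg by (intro mult_pos_pos) auto
  have R: "R \<ge> 1" unfolding R_def using divide_nonneg_pos[OF P bq] by linarith
  have "b' * P < R * (b * - helicoid_q l f)"
  proof -
    have "R * (b * - helicoid_q l f) = b * - helicoid_q l f + b' * P"
      unfolding R_def distrib_right times_divide_eq_left mult_1
      by (subst nonzero_mult_div_cancel_right) (use bq in linarith)+
    then show ?thesis using bq by linarith
  qed
  also have "\<dots> \<le> R * R * (b * - helicoid_q l f)"
    using R bq by (intro mult_right_mono) (auto simp del: mult_minus_right)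
  finally have "R * \<kappa> < 0"
    using R by (simp add: \<kappa>_def algebra_simps)
  then have \<kappa>: "\<kappa> < 0" using R by (simp add: mult_less_0_iff)
  \<comment> \<open>The field depends linearly on its coefficient, so a combination is again a
    single field with separated variables and needs no polarization of the second variation.\<close>
  have comb: "(\<lambda>x. \<Sum>i<n. c i *\<^sub>R E i x) = helicoid_normal_field l (\<lambda>x. bump_sum R n c (snd x) *\<^sub>R f (fst x))"
    for n c
  proof
    fix x
    define L where "L y = twist l (snd x) 0 y (- ((l * fst x) \<bullet> y))" for y
    have "linear L"
      unfolding L_def by (rule linearI) (simp_all add: twist_def vec_eq_iff complex_eq_iff algebra_simps)
    then have "L (\<Sum>i<n. c i *\<^sub>R (bump (snd x / R - real i) *\<^sub>R f (fst x))) =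
        (\<Sum>i<n. c i *\<^sub>R L (bump (snd x / R - real i) *\<^sub>R f (fst x)))"
      by (simp only: linear_sum linear_scale)
    then show "(\<Sum>i<n. c i *\<^sub>R E i x) = helicoid_normal_field l (\<lambda>x. bump_sum R n c (snd x) *\<^sub>R f (fst x)) x"
      by (simp add: E_def helicoid_normal_field_def bump_sum_def L_def scaleR_sum_left)
  qed
  have R0: "R > 0" using R by simp
  note prod = second_variation_product[OF f bump_sum_smooth bump_sum_compactly_supported[OF R0]]
  have "(\<integral>s. (bump_sum R n c s)\<^sup>2 \<partial>lborel) = (\<Sum>i<n. (c i)\<^sup>2) * (R * b)" for n c
    unfolding bump_sum_def b_def
    by (rule integral_disjoint_translates_square[OF bump_eq_0 continuous_bump R0])
  moreover have "(\<integral>s. (frechet_derivative (bump_sum R n c) (at s) 1)\<^sup>2 \<partial>lborel) = (\<Sum>i<n. (c i)\<^sup>2) * (b' / R)" for n c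
  proof -
    \<comment> \<open>The chain rule factor 1/R is absorbed into the coefficients; its square times
      the Jacobian \<open>R\<close> leaves 1/R.\<close>
    have "(\<integral>s. (frechet_derivative (bump_sum R n c) (at s) 1)\<^sup>2 \<partial>lborel) = (\<Sum>i<n. (c i / R)\<^sup>2) * (R * b')"
      unfolding frechet_derivative_bump_sum[OF R0] b'_def
      by (rule integral_disjoint_translates_square[OF bump'_eq_0 continuous_bump' R0])
    then show ?thesis
      using R0 by (simp add: power_divide sum_divide_distrib[symmetric] power2_eq_square)
  qed
  ultimately have "second_variation (helicoid l) (\<lambda>x. \<Sum>i<n. c i *\<^sub>R E i x) = (\<Sum>i<n. (c i)\<^sup>2) * \<kappa>" for n c
    unfolding comb prod(2) by (simp add: \<kappa>_def P_def algebra_simps)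
  moreover have "(\<lambda>x. \<Sum>i<n. c i *\<^sub>R E i x) \<in> normal_fields (helicoid l)" for n c
    unfolding comb by (rule prod(1))
  ultimately show ?thesis using \<kappa> by blast
qed

section \<open>From negative fields to infinite index\<close>

lemma sum_scaleR_fun: "(\<Sum>i\<in>I. c i *\<^sub>R E i) = (\<lambda>x. \<Sum>i\<in>I. c i *\<^sub>R E i x)"
  for E :: "'i \<Rightarrow> 'a \<Rightarrow> 'b::real_vector"
  by (induction I rule: infinite_finite_induct) (auto simp: fun_eq_iff scaleR_fun_def)

text \<open>Definiteness on combinations already forces linear independence, so the first n fields
  span an n-dimensional negative definite subspace for every n.\<close>

lemma index_submanifold_infinite:
  fixes F :: "'a::euclidean_space \<Rightarrow> 'b::euclidean_space" and E :: "nat \<Rightarrow> 'a \<Rightarrow> 'b"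
  assumes \<kappa>: "\<kappa> < 0"
    and mem: "\<And>n c. (\<lambda>x. \<Sum>i<n. c i *\<^sub>R E i x) \<in> normal_fields F"
    and Q: "\<And>n c. second_variation F (\<lambda>x. \<Sum>i<n. c i *\<^sub>R E i x) = (\<Sum>i<n. (c i)\<^sup>2) * \<kappa>"
  shows "index_submanifold F = \<infinity>"
proof -
  have zero: "c i = 0" if "(\<Sum>i<n. c i *\<^sub>R E i) = 0" "i < n" for n c i
  proof -
    \<comment> \<open>The combination is the zero field, which is also the one with all coefficients
      0; \<open>Q\<close> evaluates it in both ways.\<close>
    have "(\<Sum>i<n. (c i)\<^sup>2) * \<kappa> = (\<Sum>i<n. 0\<^sup>2) * \<kappa>"
      using Q[where n = n and c = c] Q[where n = n and c = "\<lambda>_. 0"] that(1) unfolding sum_scaleR_fun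
      by (simp add: zero_fun_def)
    then show ?thesis
      using \<kappa> that(2) by (simp add: sum_nonneg_eq_0_iff)
  qed
  have "enat n \<le> index_submanifold F" for n
  proof -
    \<comment> \<open>Independence concerns the set of fields, so repetitions must be excluded
      first; E i = E j would give a vanishing combination with coefficients 1 and -1.\<close>
    have inj: "inj_on E {..<n}"
    proof (rule inj_onI, rule ccontr)
      fix i j assume ij: "i \<in> {..<n}" "j \<in> {..<n}" "E i = E j" "i \<noteq> j"
      define c where "c k = (if k = i then 1 else 0) - (if k = j then 1 else 0 :: real)" for k
      have "(\<Sum>k<n. c k *\<^sub>R E k) = 0"
        using ij by (simp add: c_def scaleR_diff_left sum_subtractf if_distrib[of "\<lambda>r. r *\<^sub>R _"] cong: if_cong)
      from zero[OF this, of i] show False using ij by (simp add: c_def)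
    qed
    have reindex: "(\<Sum>v\<in>E ` {..<n}. g v *\<^sub>R v) = (\<Sum>i<n. g (E i) *\<^sub>R E i)" for g
      by (simp add: sum.reindex[OF inj])
    have ind: "independent (E ` {..<n})"
    proof (rule independent_if_scalars_zero)
      fix g v assume "(\<Sum>v\<in>E ` {..<n}. g v *\<^sub>R v) = 0" "v \<in> E ` {..<n}"
      then show "g v = 0"
        using zero[where c = "\<lambda>i. g (E i)" and n = n] by (auto simp: reindex)
    qed simp
    define W where "W = span (E ` {..<n})"
    have W: "\<exists>c. w = (\<Sum>i<n. c i *\<^sub>R E i)" if "w \<in> W" for w
    proof -
      have "w \<in> range (\<lambda>g. \<Sum>v\<in>E ` {..<n}. g v *\<^sub>R v)"
        using that unfolding W_def by (simp only: span_finite[OF finite_imageI[OF finite_lessThan]])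
      then obtain g where "w = (\<Sum>v\<in>E ` {..<n}. g v *\<^sub>R v)"
        by blast
      then have "w = (\<Sum>i<n. g (E i) *\<^sub>R E i)"
        unfolding reindex .
      then show ?thesis by (intro exI[where x = "\<lambda>i. g (E i)"])
    qed
    have "subspace W" by (simp add: W_def)
    moreover have "W \<subseteq> normal_fields F"
      using W mem unfolding sum_scaleR_fun by blast
    moreover have "second_variation F V < 0" if "V \<in> W" "V \<noteq> 0" for V
    proof -
      obtain c where c: "V = (\<Sum>i<n. c i *\<^sub>R E i)" using W[OF \<open>V \<in> W\<close>] by blast
      have "\<exists>i<n. c i \<noteq> 0"
        using that(2) unfolding c by (metis (no_types, lifting) lessThan_iff scaleR_zero_left sum.neutral)
      then have "(\<Sum>i<n. (c i)\<^sup>2) > 0"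
        by (auto intro!: sum_pos2)
      then show ?thesis
        using \<kappa> unfolding c sum_scaleR_fun Q by (simp add: mult_less_0_iff)
    qed
    ultimately have "edim W \<le> index_submanifold F"
      unfolding index_submanifold_def by (intro SUP_upper) auto
    moreover have "edim W = enat n"
    proof -
      have "dim W = n"
        unfolding W_def dim_span dim_eq_card_independent[OF ind] by (simp add: card_image[OF inj])
      moreover have "\<exists>B. finite B \<and> W \<subseteq> span B"
        unfolding W_def by blast
      ultimately show ?thesis by (simp add: edim_def)
    qed
    ultimately show ?thesis by simp
  qed
  \<comment> \<open>Only \<infinity> lies above every natural number.\<close>
  then show ?thesis
    by (metis enat_ord_simps(1) enat.exhaust not_less_eq_eq order_refl)
qed

theorem proposition2p2:
  fixes l :: "real^'k::finite"
  assumes "\<And>j. 0 < l $ j"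
  shows "(stable_submanifold (helicoid l) \<longleftrightarrow>
            (\<forall>f :: real^'k \<Rightarrow> real^'k. smooth_map f \<and> compactly_supported f \<longrightarrow> helicoid_q l f \<ge> 0)) \<and>
         (\<not> (\<forall>f :: real^'k \<Rightarrow> real^'k. smooth_map f \<and> compactly_supported f \<longrightarrow> helicoid_q l f \<ge> 0) \<longrightarrow>
            index_submanifold (helicoid l) = \<infinity>)"
proof (cases "\<forall>f :: real^'k \<Rightarrow> real^'k. smooth_map f \<and> compactly_supported f \<longrightarrow> helicoid_q l f \<ge> 0")
  case True
  then have "stable_submanifold (helicoid l)"
    unfolding stable_submanifold_def by (intro ballI second_variation_helicoid_nonneg) auto
  with True show ?thesis by blast
next
  case False
  then obtain f :: "real^'k \<Rightarrow> real^'k" where "smooth_map f" "compactly_supported f" "helicoid_q l f < 0"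
    by (auto simp: not_le)
  then obtain E :: "nat \<Rightarrow> (real^'k) \<times> real \<Rightarrow> (complex^'k) \<times> real" and \<kappa>
    where E: "\<kappa> < 0" "\<And>n c. (\<lambda>x. \<Sum>i<n. c i *\<^sub>R E i x) \<in> normal_fields (helicoid l)"
      "\<And>n c. second_variation (helicoid l) (\<lambda>x. \<Sum>i<n. c i *\<^sub>R E i x) = (\<Sum>i<n. (c i)\<^sup>2) * \<kappa>"
    using helicoid_negative_fields[of f l] by blast
  \<comment> \<open>The combination with n = 1 and coefficient 1 is a single field with second
    variation \<kappa> < 0.\<close>
  have "\<not> stable_submanifold (helicoid l)"
    using E(1) E(2)[where n = 1 and c = "\<lambda>_. 1"] E(3)[where n = 1 and c = "\<lambda>_. 1"] unfolding stable_submanifold_def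
    by (force simp: not_le)
  with False index_submanifold_infinite[OF E] show ?thesis by blast
qed

end
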